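(* Suppose that: (A1) $\Xi$ is compact; (A2) $c(f(\theta;x);y)$ is Lipschitz smooth in $\theta$ and $\xi=(x,y)$ with constants $L_{\theta\theta},L_{\theta\xi},L_{\xi\theta},L_{\xi\xi}$ (as in the context); (A3) $h(\theta,\gamma;\xi,\xi')$ is $\mu_h$-strongly concave in $\xi'$; (A4) for all $(\theta,\gamma)$, $\mathbb{E}_Q[\|\nabla_{\theta}H(\theta,\gamma)-\nabla_{\theta}h^{\star}(\theta,\gamma;\xi)\|^2]\le \sigma_{\theta}^2$, $\mathbb{E}_Q[\|\nabla_{\gamma}H(\theta,\gamma)-\nabla_{\gamma}h^{\star}(\theta,\gamma;\xi)\|^2]\le \sigma_{\gamma}^2$, and $H(\theta_0,\gamma_0)-\inf_{\theta,\gamma}H(\theta,\gamma)\le \Lambda$ for a constant $\Lambda>0$. Run the online DA-SGD algorithm (described in the context) for $T$ rounds with the parameters given in the context, and define $$Regret_T(\theta^{\star},\gamma^{\star})=\sum_{t=1}^T\big(h(\theta_t,\gamma_t;\xi_t,\xi_t^{\star})-h(\theta^{\star},\gamma^{\star};\xi_t,\xi^{\star})\big).$$ If $h(\theta,\gamma;\xi,\xi')$ is convex in $\theta$, then $$\mathbb{E}_Q[Regret_T(\theta^{\star},\gamma^{\star})]\le O(\sqrt T),$$ i.e. it is at most $K\sqrt T$ with $K$ independent of $T$; in particular it is sublinear in $T$, and the average regret converges at speed $O(1/\sqrt T)$.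
   Context: Points of $\Xi\subset\mathbb{R}^p\times\mathbb{R}^m$ are written $\xi=(x,y)$; $\Theta\subset\mathbb{R}^k$; $f(\theta;x)$ is a decision policy with parameter $\theta\in\Theta$; $c(z;y)$ is a real-valued cost. In the online setting the nominal distribution $Q$ is the ground-truth distribution on $\Xi$, from which a new independent sample arrives each round; $\rho>0$ is a fixed radius. The transport cost is $d(\xi,\xi')=\|x-x'\|_2+\kappa\|y-y'\|_2$ with $\kappa\in(0,\infty]$; the paper sets $\kappa=\infty$ (with $\infty\cdot 0=0$), so that only the $x$-component can be moved. On the $\xi$-space use $\|v\|=\|v_x\|_2+\kappa\|v_y\|_2$, with dual $\|g\|_*=\max\{\|g_x\|_2,\kappa^{-1}\|g_y\|_2\}$; on $\theta,\gamma$ use Euclidean norms. For $\theta\in\Theta,\gamma>0$: $h(\theta,\gamma;\xi,\xi')=c(f(\theta;x');y')-\gamma d(\xi',\xi)+\gamma\rho$, $h^{\star}(\theta,\gamma;\xi)=\sup_{\xi'\in\Xi}h(\theta,\gamma;\xi,\xi')$ (taken to be differentiable in $(\theta,\gamma)$), $H(\theta,\gamma)=\mathbb{E}_{\xi\sim Q}[h^{\star}(\theta,\gamma;\xi)]$. $(\theta^\star,\gamma^\star)$ is a minimizer of $H$ over $\Theta\times(0,\infty)$. In the regret, $\xi_t^\star$ is the maximizer of $h(\theta_t,\gamma_t;\xi_t,\cdot)$ over $\Xi$ and $\xi^\star$ (in the $t$-th term) the maximizer of $h(\theta^\star,\gamma^\star;\xi_t,\cdot)$. Lipschitz smoothness: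 with $\ell(\theta,\xi)=c(f(\theta;x);y)$, for all $\theta,\theta',\xi,\xi'$: $\|\nabla_\theta\ell(\theta,\xi)-\nabla_\theta\ell(\theta',\xi)\|_*\le L_{\theta\theta}\|\theta-\theta'\|$, $\|\nabla_\theta\ell(\theta,\xi)-\nabla_\theta\ell(\theta,\xi')\|_*\le L_{\theta\xi}\|\xi-\xi'\|$, $\|\nabla_\xi\ell(\theta,\xi)-\nabla_\xi\ell(\theta',\xi)\|_*\le L_{\xi\theta}\|\theta-\theta'\|$, $\|\nabla_\xi\ell(\theta,\xi)-\nabla_\xi\ell(\theta,\xi')\|_*\le L_{\xi\xi}\|\xi-\xi'\|$. $L_{\xi\gamma}$ is the Lipschitz constant of $\nabla_{\xi'}h$ in $\gamma$. Put $L_1=\frac{L_{\xi\gamma}}{\mu_h}$, $L_2=\frac{L_{\xi\theta}}{\mu_h}$, $L_3=\frac{L_{\theta\xi}L_{\xi\gamma}}{\mu_h}$, $L_4=L_{\theta\theta}+\frac{L_{\theta\xi}L_{\xi\theta}}{\mu_h}$, $L^2=\max(L_1^2+L_3^2+L_1L_2+L_3L_4,\,L_2^2+L_4^2+L_1L_2+L_3L_4)$. Online DA-SGD algorithm: start from initial weights. At each round $t$, a sample $\xi_t\sim Q$ arrives, independent of the past; compute an $\varepsilon$-maximizer $\hat\xi_t^\star=(\hat x_t^\star,\hat y_t^\star)$ of $\xi'\mapsto h(\theta_t,\gamma_t;\xi_t,\xi')$ (value within $\varepsilon$ of the supremum); set $\theta_{t+1}=\theta_t-\alpha\nabla_\theta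 c(f(\theta_t;\hat x_t^\star);\hat y_t^\star)$, $\gamma_{t+1}=\gamma_t-\beta[\rho-d(\hat\xi_t^\star,\xi_t)]$. Iterates are understood to stay in $\Theta\times(0,\infty)$. Parameters: $\alpha=\beta=\sqrt{\frac{\Lambda}{L(\sigma_{\theta}^2+\sigma_{\gamma}^2)T}}$, $\varepsilon=\frac{\mu_h}{(L_{\theta\xi}^2+1)\sqrt{T}}$. $\mathbb{E}_Q$ is expectation over the draws $\xi_t\sim Q$. *)

theory Defs
  imports "HOL-Probability.Probability"
begin

text \<open>\<open>THE\<close>-based, so it is meaningful only where \<^term>\<open>F\<close> is differentiable.\<close>

definition grad :: "('a::real_inner \<Rightarrow> real) \<Rightarrow> 'a \<Rightarrow> 'a" where
  "grad F x = (THE g. GDERIV F x :> g)"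

text \<open>
  The product norm of the library is not the norm used here, hence the following pair of dual
  norms on the space of points \<open>(x, y)\<close>. The weight \<open>\<kappa>\<close> ranges over \<open>(0, \<infinity>]\<close>; in \<^typ>\<open>ereal\<close> we have
  \<open>\<infinity> * 0 = 0\<close> and \<open>inverse \<infinity> = 0\<close>, so for \<open>\<kappa> = \<infinity>\<close> a displacement with a nonzero \<open>y\<close>-component has
  infinite norm, and the dual norm only sees the \<open>x\<close>-component.
\<close>

definition xi_norm :: "ereal \<Rightarrow> (real^'p) \<times> (real^'m) \<Rightarrow> ereal" where
  "xi_norm \<kappa> v = ereal (norm (fst v)) + \<kappa> * ereal (norm (snd v))"

definition xi_dual_norm :: "ereal \<Rightarrow> (real^'p) \<times> (real^'m) \<Rightarrow> ereal" where
  "xi_dual_norm \<kappa> g = max (ereal (norm (fst g))) (inverse \<kappa> * ereal (norm (snd g)))"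

definition transport_cost ::
  "ereal \<Rightarrow> (real^'p) \<times> (real^'m) \<Rightarrow> (real^'p) \<times> (real^'m) \<Rightarrow> ereal" where
  "transport_cost \<kappa> \<xi> \<xi>' = xi_norm \<kappa> (\<xi> - \<xi>')"

definition policy_loss ::
  "(real^'k \<Rightarrow> real^'p \<Rightarrow> 'z) \<Rightarrow> ('z \<Rightarrow> real^'m \<Rightarrow> real) \<Rightarrow> real^'k
    \<Rightarrow> (real^'p) \<times> (real^'m) \<Rightarrow> real" where
  "policy_loss f c \<theta> \<xi> = c (f \<theta> (fst \<xi>)) (snd \<xi>)"

text \<open>The function \<open>h(\<theta>, \<gamma>; \<xi>, \<xi>')\<close>; its value is \<open>-\<infinity>\<close> exactly when the transport cost is infinite
  (for \<open>\<gamma> > 0\<close>).\<close>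

definition dro_h ::
  "(real^'k \<Rightarrow> real^'p \<Rightarrow> 'z) \<Rightarrow> ('z \<Rightarrow> real^'m \<Rightarrow> real) \<Rightarrow> ereal \<Rightarrow> real \<Rightarrow> real^'k \<Rightarrow> real
    \<Rightarrow> (real^'p) \<times> (real^'m) \<Rightarrow> (real^'p) \<times> (real^'m) \<Rightarrow> ereal" where
  "dro_h f c \<kappa> \<rho> \<theta> \<gamma> \<xi> \<xi>' =
     ereal (policy_loss f c \<theta> \<xi>') - ereal \<gamma> * transport_cost \<kappa> \<xi>' \<xi> + ereal (\<gamma> * \<rho>)"

definition dro_h_star ::
  "(real^'k \<Rightarrow> real^'p \<Rightarrow> 'z) \<Rightarrow> ('z \<Rightarrow> real^'m \<Rightarrow> real) \<Rightarrow> ereal \<Rightarrow> real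
    \<Rightarrow> ((real^'p) \<times> (real^'m)) set \<Rightarrow> real^'k \<Rightarrow> real \<Rightarrow> (real^'p) \<times> (real^'m) \<Rightarrow> real" where
  "dro_h_star f c \<kappa> \<rho> \<Xi> \<theta> \<gamma> \<xi> = real_of_ereal (SUP \<xi>'\<in>\<Xi>. dro_h f c \<kappa> \<rho> \<theta> \<gamma> \<xi> \<xi>')"

definition dro_H ::
  "(real^'k \<Rightarrow> real^'p \<Rightarrow> 'z) \<Rightarrow> ('z \<Rightarrow> real^'m \<Rightarrow> real) \<Rightarrow> ereal \<Rightarrow> real
    \<Rightarrow> ((real^'p) \<times> (real^'m)) set \<Rightarrow> ((real^'p) \<times> (real^'m)) measure
    \<Rightarrow> real^'k \<Rightarrow> real \<Rightarrow> real" where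
  "dro_H f c \<kappa> \<rho> \<Xi> Q \<theta> \<gamma> = (\<integral>\<xi>. dro_h_star f c \<kappa> \<rho> \<Xi> \<theta> \<gamma> \<xi> \<partial>Q)"

definition lipschitz_smooth_loss ::
  "ereal \<Rightarrow> (real^'k) set \<Rightarrow> ((real^'p) \<times> (real^'m)) set
    \<Rightarrow> (real^'k \<Rightarrow> (real^'p) \<times> (real^'m) \<Rightarrow> real)
    \<Rightarrow> real \<Rightarrow> real \<Rightarrow> real \<Rightarrow> real \<Rightarrow> bool" where
  "lipschitz_smooth_loss \<kappa> \<Theta> \<Xi> l L\<theta>\<theta> L\<theta>\<xi> L\<xi>\<theta> L\<xi>\<xi> \<longleftrightarrow>
     (\<forall>\<theta>\<in>\<Theta>. \<forall>\<xi>\<in>\<Xi>. (\<lambda>\<theta>'. l \<theta>' \<xi>) differentiable (at \<theta>) \<and> l \<theta> differentiable (at \<xi>)) \<and>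
     (\<forall>\<theta>\<in>\<Theta>. \<forall>\<theta>'\<in>\<Theta>. \<forall>\<xi>\<in>\<Xi>.
        norm (grad (\<lambda>\<theta>. l \<theta> \<xi>) \<theta> - grad (\<lambda>\<theta>. l \<theta> \<xi>) \<theta>') \<le> L\<theta>\<theta> * norm (\<theta> - \<theta>')) \<and>
     (\<forall>\<theta>\<in>\<Theta>. \<forall>\<xi>\<in>\<Xi>. \<forall>\<xi>'\<in>\<Xi>.
        ereal (norm (grad (\<lambda>\<theta>. l \<theta> \<xi>) \<theta> - grad (\<lambda>\<theta>. l \<theta> \<xi>') \<theta>))
          \<le> ereal L\<theta>\<xi> * xi_norm \<kappa> (\<xi> - \<xi>')) \<and>
     (\<forall>\<theta>\<in>\<Theta>. \<forall>\<theta>'\<in>\<Theta>. \<forall>\<xi>\<in>\<Xi>.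
        xi_dual_norm \<kappa> (grad (l \<theta>) \<xi> - grad (l \<theta>') \<xi>) \<le> ereal (L\<xi>\<theta> * norm (\<theta> - \<theta>'))) \<and>
     (\<forall>\<theta>\<in>\<Theta>. \<forall>\<xi>\<in>\<Xi>. \<forall>\<xi>'\<in>\<Xi>.
        xi_dual_norm \<kappa> (grad (l \<theta>) \<xi> - grad (l \<theta>) \<xi>') \<le> ereal L\<xi>\<xi> * xi_norm \<kappa> (\<xi> - \<xi>'))"

text \<open>
  Strong concavity of a function with values in \<open>[-\<infinity>, \<infinity>)\<close>, stated on its effective domain
  \<open>D\<close> as usual for extended-valued functions. For \<open>\<kappa> = \<infinity>\<close> the effective domain of
  \<open>h(\<theta>, \<gamma>; \<xi>, _)\<close> consists of the points of \<open>\<Xi>\<close> having the same \<open>y\<close>-component as \<open>\<xi>\<close>, so that all norms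
  below are finite.
\<close>

definition strongly_concave_on ::
  "ereal \<Rightarrow> real \<Rightarrow> ((real^'p) \<times> (real^'m)) set \<Rightarrow> ((real^'p) \<times> (real^'m) \<Rightarrow> ereal) \<Rightarrow> bool" where
  "strongly_concave_on \<kappa> \<mu> S F \<longleftrightarrow>
     (let D = {\<xi>\<in>S. F \<xi> \<noteq> -\<infinity>} in
        convex D \<and>
        (\<forall>a\<in>D. \<forall>b\<in>D. \<forall>u\<in>{0..1}.
           ereal (1 - u) * F a + ereal u * F b
             + ereal (\<mu> / 2 * u * (1 - u)) * (xi_norm \<kappa> (a - b))\<^sup>2
           \<le> F ((1 - u) *\<^sub>R a + u *\<^sub>R b)))"

text \<open>
  \<open>g\<close> is the gradient in \<open>\<xi>'\<close> of an extended-valued function at a point of finiteness. For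
  \<open>\<kappa> = \<infinity>\<close> only the \<open>x\<close>-component can be moved, so only the \<open>x\<close>-gradient exists; \<open>snd g\<close> is then
  unconstrained and is ignored by \<^const>\<open>xi_dual_norm\<close>. The transport cost has kinks, so
  \<open>h(\<theta>, \<gamma>; \<xi>, _)\<close> is not differentiable everywhere; this relation is simply false at such points.
\<close>

definition has_xi_gradient ::
  "ereal \<Rightarrow> ((real^'p) \<times> (real^'m) \<Rightarrow> ereal) \<Rightarrow> (real^'p) \<times> (real^'m)
    \<Rightarrow> (real^'p) \<times> (real^'m) \<Rightarrow> bool" where
  "has_xi_gradient \<kappa> F \<xi> g \<longleftrightarrow> \<bar>F \<xi>\<bar> \<noteq> \<infinity> \<and>
     (if \<kappa> = \<infinity> then GDERIV (\<lambda>x. real_of_ereal (F (x, snd \<xi>))) (fst \<xi>) :> (fst g)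
      else GDERIV (\<lambda>\<zeta>. real_of_ereal (F \<zeta>)) \<xi> :> g)"

definition smoothness_const :: "real \<Rightarrow> real \<Rightarrow> real \<Rightarrow> real \<Rightarrow> real \<Rightarrow> real" where
  "smoothness_const L\<theta>\<theta> L\<theta>\<xi> L\<xi>\<theta> L\<xi>\<gamma> \<mu> =
     (let L1 = L\<xi>\<gamma> / \<mu>; L2 = L\<xi>\<theta> / \<mu>; L3 = L\<theta>\<xi> * L\<xi>\<gamma> / \<mu>; L4 = L\<theta>\<theta> + L\<theta>\<xi> * L\<xi>\<theta> / \<mu>
      in sqrt (max (L1\<^sup>2 + L3\<^sup>2 + L1 * L2 + L3 * L4) (L2\<^sup>2 + L4\<^sup>2 + L1 * L2 + L3 * L4)))"

definition step_size :: "real \<Rightarrow> real \<Rightarrow> real \<Rightarrow> real \<Rightarrow> nat \<Rightarrow> real" where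
  "step_size \<Lambda> L \<sigma>\<theta> \<sigma>\<gamma> T = sqrt (\<Lambda> / (L * (\<sigma>\<theta>\<^sup>2 + \<sigma>\<gamma>\<^sup>2) * real T))"

definition inner_tolerance :: "real \<Rightarrow> real \<Rightarrow> nat \<Rightarrow> real" where
  "inner_tolerance \<mu> L\<theta>\<xi> T = \<mu> / ((L\<theta>\<xi>\<^sup>2 + 1) * sqrt (real T))"

text \<open>
  A run of the online algorithm through round \<open>T\<close>, started with the weights \<open>(\<theta>0, \<gamma>0)\<close> at index \<open>s\<close>,
  on a probability space \<open>M\<close>. The processes are the iterates \<open>\<theta>\<close>, \<open>\<gamma>\<close>, the samples \<open>\<xi>\<close> and the
  approximate maximizers \<open>\<zeta>\<close>. Round \<open>t\<close>'s sample is independent of the whole past, i.e. of the iterates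
  up to \<open>t\<close> and of the samples and approximate maximizers before \<open>t\<close>; the choice of the approximate
  maximizers is otherwise arbitrary (and possibly randomized). (The library's \<open>indep_var\<close> needs both
  random variables to have the same type, hence the \<open>\<sigma>\<close>-algebras generated by them.)
\<close>

definition online_da_sgd_run ::
  "(real^'k \<Rightarrow> real^'p \<Rightarrow> 'z) \<Rightarrow> ('z \<Rightarrow> real^'m \<Rightarrow> real) \<Rightarrow> ereal \<Rightarrow> real
    \<Rightarrow> (real^'k) set \<Rightarrow> ((real^'p) \<times> (real^'m)) set \<Rightarrow> ((real^'p) \<times> (real^'m)) measure
    \<Rightarrow> real \<Rightarrow> real \<Rightarrow> real \<Rightarrow> real^'k \<Rightarrow> real \<Rightarrow> nat \<Rightarrow> nat \<Rightarrow> 'w measure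
    \<Rightarrow> (nat \<Rightarrow> 'w \<Rightarrow> real^'k) \<Rightarrow> (nat \<Rightarrow> 'w \<Rightarrow> real)
    \<Rightarrow> (nat \<Rightarrow> 'w \<Rightarrow> (real^'p) \<times> (real^'m)) \<Rightarrow> (nat \<Rightarrow> 'w \<Rightarrow> (real^'p) \<times> (real^'m)) \<Rightarrow> bool" where
  "online_da_sgd_run f c \<kappa> \<rho> \<Theta> \<Xi> Q \<alpha> \<beta> \<epsilon> \<theta>0 \<gamma>0 s T M \<theta> \<gamma> \<xi> \<zeta> \<longleftrightarrow>
     prob_space M \<and>
     (\<forall>t\<in>{s..T}.
        \<theta> t \<in> borel_measurable M \<and> \<gamma> t \<in> borel_measurable M \<and>
        \<xi> t \<in> borel_measurable M \<and> \<zeta> t \<in> borel_measurable M \<and>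
        distr M borel (\<xi> t) = Q \<and>
        prob_space.indep_set M
          (sets (vimage_algebra (space M)
             (\<lambda>\<omega>. (\<lambda>j\<in>{s..t}. (\<theta> j \<omega>, \<gamma> j \<omega>), \<lambda>j\<in>{s..<t}. (\<xi> j \<omega>, \<zeta> j \<omega>)))
             (PiM {s..t} (\<lambda>_. borel) \<Otimes>\<^sub>M PiM {s..<t} (\<lambda>_. borel))))
          (sets (vimage_algebra (space M) (\<xi> t) borel))) \<and>
     (\<forall>\<omega>\<in>space M.
        \<theta> s \<omega> = \<theta>0 \<and> \<gamma> s \<omega> = \<gamma>0 \<and>
        (\<forall>t\<in>{s..T}.
           \<theta> t \<omega> \<in> \<Theta> \<and> 0 < \<gamma> t \<omega> \<and> \<xi> t \<omega> \<in> \<Xi> \<and> \<zeta> t \<omega> \<in> \<Xi> \<and>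
           (SUP \<xi>'\<in>\<Xi>. dro_h f c \<kappa> \<rho> (\<theta> t \<omega>) (\<gamma> t \<omega>) (\<xi> t \<omega>) \<xi>') - ereal \<epsilon>
             \<le> dro_h f c \<kappa> \<rho> (\<theta> t \<omega>) (\<gamma> t \<omega>) (\<xi> t \<omega>) (\<zeta> t \<omega>) \<and>
           \<theta> (Suc t) \<omega> = \<theta> t \<omega> - \<alpha> *\<^sub>R grad (\<lambda>\<eta>. policy_loss f c \<eta> (\<zeta> t \<omega>)) (\<theta> t \<omega>) \<and>
           \<gamma> (Suc t) \<omega> = \<gamma> t \<omega> - \<beta> * (\<rho> - real_of_ereal (transport_cost \<kappa> (\<zeta> t \<omega>) (\<xi> t \<omega>)))))"

definition worst_case ::
  "(real^'k \<Rightarrow> real^'p \<Rightarrow> 'z) \<Rightarrow> ('z \<Rightarrow> real^'m \<Rightarrow> real) \<Rightarrow> ereal \<Rightarrow> real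
    \<Rightarrow> ((real^'p) \<times> (real^'m)) set \<Rightarrow> real^'k \<Rightarrow> real
    \<Rightarrow> (real^'p) \<times> (real^'m) \<Rightarrow> (real^'p) \<times> (real^'m)" where
  "worst_case f c \<kappa> \<rho> \<Xi> \<theta> \<gamma> \<xi> = arg_max_on (dro_h f c \<kappa> \<rho> \<theta> \<gamma> \<xi>) \<Xi>"

definition regret ::
  "(real^'k \<Rightarrow> real^'p \<Rightarrow> 'z) \<Rightarrow> ('z \<Rightarrow> real^'m \<Rightarrow> real) \<Rightarrow> ereal \<Rightarrow> real
    \<Rightarrow> ((real^'p) \<times> (real^'m)) set \<Rightarrow> nat
    \<Rightarrow> (nat \<Rightarrow> 'w \<Rightarrow> real^'k) \<Rightarrow> (nat \<Rightarrow> 'w \<Rightarrow> real) \<Rightarrow> (nat \<Rightarrow> 'w \<Rightarrow> (real^'p) \<times> (real^'m))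
    \<Rightarrow> real^'k \<Rightarrow> real \<Rightarrow> 'w \<Rightarrow> real" where
  "regret f c \<kappa> \<rho> \<Xi> T \<theta> \<gamma> \<xi> \<theta>s \<gamma>s \<omega> =
     (\<Sum>t=1..T.
        real_of_ereal (dro_h f c \<kappa> \<rho> (\<theta> t \<omega>) (\<gamma> t \<omega>) (\<xi> t \<omega>)
          (worst_case f c \<kappa> \<rho> \<Xi> (\<theta> t \<omega>) (\<gamma> t \<omega>) (\<xi> t \<omega>)))
        - real_of_ereal (dro_h f c \<kappa> \<rho> \<theta>s \<gamma>s (\<xi> t \<omega>)
          (worst_case f c \<kappa> \<rho> \<Xi> \<theta>s \<gamma>s (\<xi> t \<omega>))))"

end

theory Submission
  imports Defs
begin

text \<open>
  The function \<open>h\<close> is a convex function of \<open>\<theta>\<close> plus an affine function of \<open>\<gamma>\<close>, so the gradient of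
  \<open>h(\<cdot>; \<xi>\<^sub>t, \<zeta>\<^sub>t)\<close> at the iterate \<open>w\<^sub>t = (\<theta>\<^sub>t, \<gamma>\<^sub>t)\<close> is an \<open>\<epsilon>\<close>-subgradient of \<open>h\<^sup>\<star>(\<cdot>; \<xi>\<^sub>t)\<close>. Its norm grows
  at most like \<open>B + L \<parallel>w\<^sub>t - w\<^sup>\<star>\<parallel>\<close>. Expanding \<open>\<parallel>w\<^sub>t\<^sub>+\<^sub>1 - w\<^sup>\<star>\<parallel>\<^sup>2\<close> with step size \<open>a / sqrt T\<close> and tolerance
  \<open>q / sqrt T\<close> gives, for the expectations \<open>e\<^sub>t\<close> of the squared distances and \<open>r\<^sub>t\<close> of the regret terms,
  \<open>e\<^sub>t\<^sub>+\<^sub>1 \<le> (1 + b / T) e\<^sub>t + c / T - 2 a r\<^sub>t / sqrt T\<close>. Independence of \<open>\<xi>\<^sub>t\<close> from \<open>w\<^sub>t\<close> and minimality of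
  \<open>w\<^sup>\<star>\<close> give \<open>r\<^sub>t \<ge> 0\<close>, so a discrete Gronwall argument bounds both the \<open>e\<^sub>t\<close> and \<open>(\<Sum>t. r\<^sub>t) / sqrt T\<close>.
  Only increments between points of \<open>\<Theta>\<close> are controlled, so the last round, whose update may leave
  \<open>\<Theta>\<close>, is estimated directly.
\<close>

section \<open>Gradients, convexity and bounds on spans\<close>

text \<open>On a Euclidean space a derivative is the inner product with the vector of its values on
  the basis. Uniqueness of derivatives then makes the definite description in \<open>grad\<close>
  denote this vector.\<close>

lemma GDERIV_grad:
  fixes F :: "'a::euclidean_space \<Rightarrow> real"
  assumes "F differentiable (at x)"
  shows "GDERIV F x :> grad F x"
proof -
  obtain F' where F': "(F has_derivative F') (at x)"
    using assms by (auto simp: differentiable_def)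
  define g where "g = (\<Sum>b\<in>Basis. F' b *\<^sub>R b)"
  have "F' v = v \<bullet> g" for v
  proof -
    interpret linear F' using F' by (rule has_derivative_linear)
    have "F' v = F' (\<Sum>b\<in>Basis. (v \<bullet> b) *\<^sub>R b)"
      by (simp add: euclidean_representation)
    then show ?thesis
      by (simp add: sum scale g_def inner_sum_right mult.commute)
  qed
  then have "F' = (\<lambda>v. v \<bullet> g)" by auto
  with F' have "GDERIV F x :> g" by (simp add: gderiv_def)
  moreover have "g' = g" if "GDERIV F x :> g'" for g'
  proof -
    have "(\<lambda>v. v \<bullet> g') = (\<lambda>v. v \<bullet> g)"
      using that \<open>GDERIV F x :> g\<close> has_derivative_unique unfolding gderiv_def by blast
    then show ?thesis by (metis inner_commute vector_eq_ldot)
  qed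
  ultimately show ?thesis
    unfolding grad_def by (rule theI)
qed

text \<open>Along the segment from \<open>x\<close> to \<open>y\<close>, convexity bounds every
  difference quotient by \<open>f y - f x\<close>, and the quotients tend to the directional
  derivative.\<close>

lemma convex_on_gradient_le:
  assumes f: "convex_on S f" and x: "x \<in> S" and y: "y \<in> S" and g: "GDERIV f x :> g"
  shows "g \<bullet> (y - x) \<le> f y - f x"
proof -
  define \<phi> where "\<phi> t = f (x + t *\<^sub>R (y - x))" for t :: real
  have "(\<phi> has_derivative (\<lambda>t. (t *\<^sub>R (y - x)) \<bullet> g)) (at 0)"
  proof -
    have "((\<lambda>t. x + t *\<^sub>R (y - x)) has_derivative (\<lambda>t. t *\<^sub>R (y - x))) (at 0)"
      by (auto intro!: derivative_eq_intros)
    moreover have "(f has_derivative (\<lambda>h. h \<bullet> g)) (at (x + 0 *\<^sub>R (y - x)))"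
      using g by (simp add: gderiv_def)
    ultimately show ?thesis
      unfolding \<phi>_def by (rule has_derivative_compose)
  qed
  then have "(\<phi> has_real_derivative g \<bullet> (y - x)) (at 0)"
    by (simp add: has_field_derivative_def inner_commute mult_commute_abs)
  then have "((\<lambda>t. (\<phi> t - \<phi> 0) / t) \<longlongrightarrow> g \<bullet> (y - x)) (at 0)"
    by (simp add: has_field_derivative_iff)
  \<comment> \<open>Convexity is known on \<open>S\<close> only, hence for \<open>t\<close> between
    0 and 1, so the limit is taken from the right.\<close>
  then have "((\<lambda>t. (\<phi> t - \<phi> 0) / t) \<longlongrightarrow> g \<bullet> (y - x)) (at_right 0)"
    by (rule filterlim_mono) (auto simp: at_le)
  moreover have "\<forall>\<^sub>F t in at_right 0. (\<phi> t - \<phi> 0) / t \<le> f y - f x"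
    unfolding eventually_at_right_field
  proof (intro exI[of _ 1] conjI allI impI)
    fix t :: real assume t: "0 < t" "t < 1"
    have "\<phi> t \<le> (1 - t) * f x + t * f y"
      using convex_onD[OF f, of t x y] t x y by (simp add: \<phi>_def algebra_simps)
    then have "\<phi> t - \<phi> 0 \<le> (f y - f x) * t"
      by (simp add: \<phi>_def algebra_simps)
    then show "(\<phi> t - \<phi> 0) / t \<le> f y - f x"
      using t by (simp add: divide_le_eq)
  qed simp
  ultimately show ?thesis
    by (rule tendsto_upperbound) simp
qed

text \<open>A uniform boundedness principle in finite dimension: pointwise bounds pass to linear
  combinations, and the finitely many bounds on an orthonormal basis of the span add up to one
  constant. The components of \<open>g\<close> orthogonal to the span stay uncontrolled.\<close>

lemma pointwise_bounded_on_span: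
  fixes S G :: "'a::euclidean_space set"
  assumes "\<And>v. v \<in> S \<Longrightarrow> \<exists>C. \<forall>g\<in>G. \<bar>g \<bullet> v\<bar> \<le> C"
  shows "\<exists>B\<ge>0. \<forall>g\<in>G. \<forall>v\<in>span S. \<bar>g \<bullet> v\<bar> \<le> B * norm v"
proof -
  have span: "\<exists>C. \<forall>g\<in>G. \<bar>g \<bullet> v\<bar> \<le> C" if "v \<in> span S" for v
    using that
  proof (induction rule: span_induct_alt)
    case base
    then show ?case by (intro exI[of _ 0]) simp
  next
    case (step c x y)
    obtain C1 C2 where "\<forall>g\<in>G. \<bar>g \<bullet> x\<bar> \<le> C1" "\<forall>g\<in>G. \<bar>g \<bullet> y\<bar> \<le> C2"
      using step assms by blast
    then have "\<bar>g \<bullet> (c *\<^sub>R x + y)\<bar> \<le> \<bar>c\<bar> * C1 + C2" if "g \<in> G" for g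
    proof -
      have "\<bar>g \<bullet> (c *\<^sub>R x + y)\<bar> \<le> \<bar>c\<bar> * \<bar>g \<bullet> x\<bar> + \<bar>g \<bullet> y\<bar>"
        by (simp add: inner_add_right) (metis abs_mult abs_triangle_ineq)
      also have "\<dots> \<le> \<bar>c\<bar> * C1 + C2"
        using \<open>\<forall>g\<in>G. \<bar>g \<bullet> x\<bar> \<le> C1\<close> \<open>\<forall>g\<in>G. \<bar>g \<bullet> y\<bar> \<le> C2\<close> that
        by (intro add_mono mult_left_mono) auto
      finally show ?thesis .
    qed
    then show ?case by blast
  qed
  obtain E where E: "E \<subseteq> span S" "pairwise orthogonal E" "\<And>b. b \<in> E \<Longrightarrow> norm b = 1"
    "independent E" "span E = span S"
    using orthonormal_basis_subspace[OF subspace_span[of S]] by metis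
  have fin: "finite E" using E(4) by (rule independent_imp_finite)
  obtain C where C: "\<And>b g. b \<in> E \<Longrightarrow> g \<in> G \<Longrightarrow> \<bar>g \<bullet> b\<bar> \<le> C b"
    using span E(1) by (metis subsetD)
  show ?thesis
  proof (intro exI[of _ "\<Sum>b\<in>E. \<bar>C b\<bar>"] conjI ballI)
    fix g v assume g: "g \<in> G" and v: "v \<in> span S"
    have "v = (\<Sum>b\<in>E. (v \<bullet> b) *\<^sub>R b)"
      using orthonormal_basis_expand[OF E(2) E(3) _ fin] v E(5) by simp
    then have "g \<bullet> v = (\<Sum>b\<in>E. (v \<bullet> b) * (g \<bullet> b))"
      by (metis (no_types, lifting) inner_scaleR_right inner_sum_right sum.cong)
    also have "\<bar>\<dots>\<bar> \<le> (\<Sum>b\<in>E. \<bar>v \<bullet> b\<bar> * \<bar>g \<bullet> b\<bar>)"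
      by (rule order_trans[OF sum_abs]) (simp add: abs_mult)
    also have "\<dots> \<le> (\<Sum>b\<in>E. norm v * \<bar>C b\<bar>)"
    proof (intro sum_mono mult_mono)
      fix b assume "b \<in> E"
      then show "\<bar>v \<bullet> b\<bar> \<le> norm v" "\<bar>g \<bullet> b\<bar> \<le> \<bar>C b\<bar>"
        using Cauchy_Schwarz_ineq2[of v b] E(3) C g by fastforce+
    qed auto
    finally show "\<bar>g \<bullet> v\<bar> \<le> (\<Sum>b\<in>E. \<bar>C b\<bar>) * norm v"
      by (simp add: sum_distrib_left mult.commute)
  qed (simp add: sum_nonneg)
qed

section \<open>Independence and expectations with a random parameter\<close>

text \<open>An event determined by a measurable function of \<open>X\<close> is determined by
  \<open>X\<close>. This is how independence passes to functions of the independent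
  quantities.\<close>

lemma sets_vimage_algebra_comp_subset:
  assumes "X \<in> \<Omega> \<rightarrow> space N" "g \<in> measurable N K"
  shows "sets (vimage_algebra \<Omega> (\<lambda>\<omega>. g (X \<omega>)) K) \<subseteq> sets (vimage_algebra \<Omega> X N)"
proof (rule sets_image_in_sets)
  show "(\<lambda>\<omega>. g (X \<omega>)) \<in> measurable (vimage_algebra \<Omega> X N) K"
    using measurable_compose[OF measurable_vimage_algebra1[OF assms(1)] assms(2)] .
qed simp

text \<open>The joint measurability of \<^term>\<open>F\<close> is not available, since \<^term>\<open>W\<close> need not be Borel;
  so \<^term>\<open>X\<close> is approximated by random variables taking countably many values in \<^term>\<open>W\<close>.\<close>

lemma (in prob_space) expectation_indep_nonneg:
  fixes X :: "'a \<Rightarrow> 'b::euclidean_space" and F :: "'b \<Rightarrow> 'c \<Rightarrow> real"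
  assumes X[measurable]: "X \<in> borel_measurable M" and Y[measurable]: "Y \<in> measurable M N"
    and indep: "indep_set (sets (vimage_algebra (space M) X borel)) (sets (vimage_algebra (space M) Y N))"
    and W: "\<And>\<omega>. \<omega> \<in> space M \<Longrightarrow> X \<omega> \<in> W"
    and F_meas: "\<And>w. w \<in> W \<Longrightarrow> F w \<in> borel_measurable N"
    and cont: "\<And>\<omega>. \<omega> \<in> space M \<Longrightarrow> continuous_on W (\<lambda>w. F w (Y \<omega>))"
    and bdd: "\<And>w \<omega>. w \<in> W \<Longrightarrow> \<omega> \<in> space M \<Longrightarrow> \<bar>F w (Y \<omega>)\<bar> \<le> C"
    and nonneg: "\<And>w. w \<in> W \<Longrightarrow> 0 \<le> expectation (\<lambda>\<omega>. F w (Y \<omega>))"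
  shows "integrable M (\<lambda>\<omega>. F (X \<omega>) (Y \<omega>))" "0 \<le> expectation (\<lambda>\<omega>. F (X \<omega>) (Y \<omega>))"
proof -
  obtain D where D: "countable D" "D \<subseteq> W" "W \<subseteq> closure D"
    using separable by blast
  obtain \<omega>0 where \<omega>0: "\<omega>0 \<in> space M" using not_empty by blast
  have "D \<noteq> {}" using W[OF \<omega>0] D(3) by auto
  define d where "d = from_nat_into D"
  have d_range: "range d = D" unfolding d_def using \<open>D \<noteq> {}\<close> D(1) by (rule range_from_nat_into)
  then have d: "d k \<in> W" for k using D(2) by auto
  have C: "0 \<le> C" using bdd[OF d \<omega>0] abs_ge_zero order_trans by blast
  have [measurable]: "(\<lambda>\<omega>. F (d k) (Y \<omega>)) \<in> borel_measurable M" for k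
    using F_meas[OF d] by measurable
  \<comment> \<open>The first point of the dense sequence close enough to \<open>x\<close>. Taking
    the least index keeps the choice Borel measurable; the distance estimate is claimed on
    \<open>W\<close> only.\<close>
  define J where "J n x = (LEAST k. dist x (d k) < inverse (real (Suc n)))" for n x
  have J_meas[measurable]: "J n \<in> measurable borel (count_space UNIV)" for n
    unfolding J_def by measurable
  have J: "dist x (d (J n x)) < inverse (real (Suc n))" if "x \<in> W" for n x
  proof -
    have pos: "0 < inverse (real (Suc n))" by simp
    have "x \<in> closure D" using that D(3) by blast
    then have "\<exists>y\<in>D. dist y x < inverse (real (Suc n))"
      using pos unfolding closure_approachable by blast
    then obtain y where "y \<in> D" "dist y x < inverse (real (Suc n))" ..
    moreover from this obtain k where "y = d k"
      using d_range by blast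
    ultimately have "dist x (d k) < inverse (real (Suc n))"
      by (simp add: dist_commute)
    then show ?thesis unfolding J_def by (rule LeastI)
  qed
  define u where "u n \<omega> = F (d (J n (X \<omega>))) (Y \<omega>)" for n \<omega>
  have u_meas[measurable]: "u n \<in> borel_measurable M" for n
    unfolding u_def by measurable
  have u_nonneg: "0 \<le> expectation (u n)" for n
  proof -
    \<comment> \<open>Splitting by the chosen index freezes the parameter at \<open>d k\<close>, so
      the two factors depend on \<open>X\<close> and on \<open>Y\<close> alone and the expectation
      of their product factorizes.\<close>
    define v where "v k \<omega> = of_bool (J n (X \<omega>) = k) * F (d k) (Y \<omega>)" for k \<omega>
    have [measurable]: "v k \<in> borel_measurable M" for k unfolding v_def by measurable
    have v_int: "integrable M (v k)" for k
      by (rule integrable_const_bound[of _ C])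
        (use bdd[OF d] C in \<open>auto simp: v_def\<close>)
    have v_nonneg: "0 \<le> expectation (v k)" for k
    proof -
      have "indep_var borel (\<lambda>\<omega>. of_bool (J n (X \<omega>) = k) :: real) borel (\<lambda>\<omega>. F (d k) (Y \<omega>))"
        unfolding indep_var_eq sets_vimage_algebra[symmetric]
      proof (intro conjI)
        have 1: "sets (vimage_algebra (space M) (\<lambda>\<omega>. of_bool (J n (X \<omega>) = k) :: real) borel)
          \<subseteq> sets (vimage_algebra (space M) X borel)"
          by (rule sets_vimage_algebra_comp_subset[where g="\<lambda>x. of_bool (J n x = k)"]) simp_all
        have 2: "sets (vimage_algebra (space M) (\<lambda>\<omega>. F (d k) (Y \<omega>)) borel)
          \<subseteq> sets (vimage_algebra (space M) Y N)"
          using F_meas[OF d] measurable_space[OF Y] by (intro sets_vimage_algebra_comp_subset) auto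
        show "indep_set (sets (vimage_algebra (space M) (\<lambda>\<omega>. of_bool (J n (X \<omega>) = k) :: real) borel))
           (sets (vimage_algebra (space M) (\<lambda>\<omega>. F (d k) (Y \<omega>)) borel))"
          using indep 1 2 unfolding indep_sets2_eq by blast
      qed measurable
      then have "expectation (v k) = expectation (\<lambda>\<omega>. of_bool (J n (X \<omega>) = k)) * expectation (\<lambda>\<omega>. F (d k) (Y \<omega>))"
        unfolding v_def
      proof (rule indep_var_lebesgue_integral)
        show "integrable M (\<lambda>\<omega>. of_bool (J n (X \<omega>) = k) :: real)"
          by (rule integrable_const_bound[of _ 1]) auto
        show "integrable M (\<lambda>\<omega>. F (d k) (Y \<omega>))"
          by (rule integrable_const_bound[of _ C]) (use bdd[OF d] in auto)
      qed
      also have "\<dots> \<ge> 0"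
        using nonneg[OF d] by (intro mult_nonneg_nonneg integral_nonneg) auto
      finally show ?thesis .
    qed
    \<comment> \<open>At most one summand survives, so the constant \<open>C\<close> dominates all
      partial sums, and they are eventually equal to \<open>u n\<close>.\<close>
    have partial: "(\<Sum>k<m. v k \<omega>) = (if J n (X \<omega>) < m then u n \<omega> else 0)" for m \<omega>
      by (simp add: v_def u_def of_bool_def if_distrib[where f="\<lambda>a. a * _"] sum.delta cong: if_cong)
    have "(\<lambda>m. expectation (\<lambda>\<omega>. \<Sum>k<m. v k \<omega>)) \<longlonglongrightarrow> expectation (u n)"
    proof (rule integral_dominated_convergence[where w="\<lambda>_. C"])
      show "AE \<omega> in M. (\<lambda>m. \<Sum>k<m. v k \<omega>) \<longlonglongrightarrow> u n \<omega>"
      proof (rule AE_I2)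
        fix \<omega>
        show "(\<lambda>m. \<Sum>k<m. v k \<omega>) \<longlonglongrightarrow> u n \<omega>"
          unfolding partial
          by (rule tendsto_eventually)
            (use eventually_gt_at_top[of "J n (X \<omega>)"] in eventually_elim, simp)
      qed
      show "AE \<omega> in M. norm (\<Sum>k<m. v k \<omega>) \<le> C" for m
        unfolding partial using bdd[OF d] C by (auto simp: u_def)
    qed auto
    moreover have "0 \<le> expectation (\<lambda>\<omega>. \<Sum>k<m. v k \<omega>)" for m
      using v_int v_nonneg by (simp add: sum_nonneg)
    ultimately show ?thesis
      by (intro LIMSEQ_le_const) auto
  qed
  have lim: "(\<lambda>n. u n \<omega>) \<longlonglongrightarrow> F (X \<omega>) (Y \<omega>)" if \<omega>: "\<omega> \<in> space M" for \<omega>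
  proof -
    have "(\<lambda>n. dist (X \<omega>) (d (J n (X \<omega>)))) \<longlonglongrightarrow> 0"
    proof (rule tendsto_sandwich[OF _ _ tendsto_const LIMSEQ_inverse_real_of_nat])
      show "\<forall>\<^sub>F n in sequentially. dist (X \<omega>) (d (J n (X \<omega>))) \<le> inverse (real (Suc n))"
        by (intro always_eventually allI less_imp_le J W \<omega>)
    qed simp
    then have "(\<lambda>n. dist (d (J n (X \<omega>))) (X \<omega>)) \<longlonglongrightarrow> 0"
      by (subst dist_commute)
    then have "(\<lambda>n. d (J n (X \<omega>))) \<longlonglongrightarrow> X \<omega>"
      by (rule tendsto_dist_iff[THEN iffD2])
    then show ?thesis
      unfolding u_def by (rule continuous_on_tendsto_compose[OF cont[OF \<omega>] _ W[OF \<omega>]]) (simp add: d)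
  qed
  have meas[measurable]: "(\<lambda>\<omega>. F (X \<omega>) (Y \<omega>)) \<in> borel_measurable M"
    using u_meas lim by (rule borel_measurable_LIMSEQ_real[rotated])
  show "integrable M (\<lambda>\<omega>. F (X \<omega>) (Y \<omega>))"
    by (rule integrable_const_bound[of _ C]) (use bdd W in auto)
  have "(\<lambda>n. expectation (u n)) \<longlonglongrightarrow> expectation (\<lambda>\<omega>. F (X \<omega>) (Y \<omega>))"
    by (rule integral_dominated_convergence[where w="\<lambda>_. C"])
      (use lim bdd d in \<open>auto simp: u_def\<close>)
  then show "0 \<le> expectation (\<lambda>\<omega>. F (X \<omega>) (Y \<omega>))"
    by (rule LIMSEQ_le_const) (use u_nonneg in auto)
qed

section \<open>A discrete Gronwall inequality\<close>

text \<open>The accumulated sum of the \<open>r j\<close> is carried along with \<open>e\<close>: it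
  is non-negative and the growth factor is at least 1, so multiplying the sum by this factor as well
  only weakens the recursion. At most \<open>T\<close> factors \<open>1 + b / T\<close> give no more
  than \<open>exp b\<close>.\<close>

lemma discrete_gronwall_regret:
  fixes e r :: "nat \<Rightarrow> real"
  assumes T: "0 < T" and n: "n \<le> T" and b: "0 \<le> b" and c: "0 \<le> c" and a: "0 < a"
    and e: "\<And>j. j \<le> n \<Longrightarrow> 0 \<le> e j" and r: "\<And>j. j < n \<Longrightarrow> 0 \<le> r j"
    and step: "\<And>j. j < n \<Longrightarrow> e (Suc j) \<le> (1 + b / real T) * e j + c / real T - a * r j"
  shows "e n + a * (\<Sum>j<n. r j) \<le> exp b * (e 0 + c)"
proof -
  define q where "q = 1 + b / real T"
  have q: "1 \<le> q" unfolding q_def using b by simp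
  have ind: "m \<le> n \<Longrightarrow> e m + a * (\<Sum>j<m. r j) \<le> q ^ m * (e 0 + real m * c / real T)" for m
  proof (induction m)
    case (Suc m)
    let ?S = "a * (\<Sum>j<m. r j)"
    have S: "0 \<le> ?S" using Suc.prems r a by (intro mult_nonneg_nonneg sum_nonneg) auto
    have "e (Suc m) + a * (\<Sum>j<Suc m. r j) \<le> q * e m + c / real T + ?S"
      using step[of m] Suc.prems by (simp add: q_def algebra_simps)
    also have "\<dots> \<le> q * (e m + ?S) + c / real T"
      using mult_right_mono[OF q S] by (simp add: algebra_simps)
    \<comment> \<open>The new error \<open>c / T\<close> is enlarged by \<open>q ^ Suc m\<close>, so
      that this power can be factored out.\<close>
    also have "\<dots> \<le> q * (q ^ m * (e 0 + real m * c / real T)) + q ^ Suc m * (c / real T)"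
      using Suc q c mult_right_mono[OF one_le_power[OF q, of "Suc m"], of "c / real T"]
      by (intro add_mono mult_left_mono) auto
    also have "\<dots> = q ^ Suc m * (e 0 + real (Suc m) * c / real T)"
      by (simp add: algebra_simps add_divide_distrib)
    finally show ?case .
  qed simp
  have "e n + a * (\<Sum>j<n. r j) \<le> q ^ n * (e 0 + real n * c / real T)" using ind by simp
  also have "\<dots> \<le> exp b * (e 0 + c)"
  proof (rule mult_mono)
    have "q ^ n \<le> q ^ T" using n q by (rule power_increasing)
    also have "\<dots> \<le> exp (b / real T) ^ T"
      unfolding q_def using b by (intro power_mono exp_ge_add_one_self) auto
    also have "\<dots> = exp b" using T by (simp flip: exp_of_nat_mult)
    finally show "q ^ n \<le> exp b" .
    have "real n * c \<le> c * real T" using n c by (simp add: mult.commute mult_right_mono mult_left_mono)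
    then show "e 0 + real n * c / real T \<le> e 0 + c" using T by (simp add: divide_le_eq)
  qed (use e[of 0] c in auto)
  finally show ?thesis .
qed

section \<open>The inner maximization and its subgradients\<close>

text \<open>Collects the deterministic data. \<open>L\<close> stands for the constant
  \<open>L\<theta>\<theta>\<close>; continuity and convexity are stated for the loss itself, the
  form in which the estimates below apply them.\<close>

locale convex_dro =
  fixes f :: "real^'k \<Rightarrow> real^'p \<Rightarrow> 'z" and c :: "'z \<Rightarrow> real^'m \<Rightarrow> real"
    and \<kappa> :: ereal and \<rho> L :: real and \<Theta> :: "(real^'k) set"
    and \<Xi> :: "((real^'p) \<times> (real^'m)) set"
  assumes kappa: "0 < \<kappa>" and rho: "0 < \<rho>" and L_nonneg: "0 \<le> L"
    and compact_\<Xi>: "compact \<Xi>"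
    and loss_differentiable: "\<And>\<theta> \<xi>. \<theta> \<in> \<Theta> \<Longrightarrow> \<xi> \<in> \<Xi> \<Longrightarrow> (\<lambda>\<eta>. policy_loss f c \<eta> \<xi>) differentiable (at \<theta>)"
    and loss_continuous: "\<And>\<theta>. \<theta> \<in> \<Theta> \<Longrightarrow> continuous_on \<Xi> (policy_loss f c \<theta>)"
    and grad_lipschitz: "\<And>\<theta> \<theta>' \<xi>. \<theta> \<in> \<Theta> \<Longrightarrow> \<theta>' \<in> \<Theta> \<Longrightarrow> \<xi> \<in> \<Xi> \<Longrightarrow>
      norm (grad (\<lambda>\<eta>. policy_loss f c \<eta> \<xi>) \<theta> - grad (\<lambda>\<eta>. policy_loss f c \<eta> \<xi>) \<theta>') \<le> L * norm (\<theta> - \<theta>')"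
    and loss_convex: "\<And>\<xi>. \<xi> \<in> \<Xi> \<Longrightarrow> convex_on \<Theta> (\<lambda>\<theta>. policy_loss f c \<theta> \<xi>)"
begin

text \<open>For \<gamma> > 0 this is the effective domain of \<open>dro_h\<close> within
  \<open>\<Xi>\<close>.\<close>

definition feasible :: "(real^'p) \<times> (real^'m) \<Rightarrow> ((real^'p) \<times> (real^'m)) set" where
  "feasible \<xi> = {\<xi>' \<in> \<Xi>. transport_cost \<kappa> \<xi>' \<xi> < \<infinity>}"

text \<open>Since \<^term>\<open>real_of_ereal \<infinity> = 0\<close>, this is the transport cost on feasible points also if
  \<^term>\<open>\<kappa> = \<infinity>\<close>.\<close>

definition fin_cost :: "(real^'p) \<times> (real^'m) \<Rightarrow> (real^'p) \<times> (real^'m) \<Rightarrow> real" where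
  "fin_cost \<xi>' \<xi> = norm (fst \<xi>' - fst \<xi>) + real_of_ereal \<kappa> * norm (snd \<xi>' - snd \<xi>)"

definition fin_h :: "real^'k \<Rightarrow> real \<Rightarrow> (real^'p) \<times> (real^'m) \<Rightarrow> (real^'p) \<times> (real^'m) \<Rightarrow> real" where
  "fin_h \<theta> \<gamma> \<xi> \<xi>' = policy_loss f c \<theta> \<xi>' - \<gamma> * fin_cost \<xi>' \<xi> + \<gamma> * \<rho>"

abbreviation h_star :: "real^'k \<Rightarrow> real \<Rightarrow> (real^'p) \<times> (real^'m) \<Rightarrow> real" where
  "h_star \<equiv> dro_h_star f c \<kappa> \<rho> \<Xi>"

abbreviation loss_grad :: "real^'k \<Rightarrow> (real^'p) \<times> (real^'m) \<Rightarrow> real^'k" where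
  "loss_grad \<theta> \<xi> \<equiv> grad (\<lambda>\<eta>. policy_loss f c \<eta> \<xi>) \<theta>"

text \<open>The gradient of \<open>fin_h\<close> in the pair (\<theta>, \<gamma>), which is also the
  direction of the algorithm's update.\<close>

definition subgradient :: "real^'k \<Rightarrow> (real^'p) \<times> (real^'m) \<Rightarrow> (real^'p) \<times> (real^'m) \<Rightarrow> (real^'k) \<times> real" where
  "subgradient \<theta> \<xi> \<xi>' = (loss_grad \<theta> \<xi>', \<rho> - fin_cost \<xi>' \<xi>)"

lemma kappa_cases: "\<kappa> = \<infinity> \<or> (\<exists>k>0. \<kappa> = ereal k)"
  using kappa by (cases \<kappa>) auto

lemma feasible_eq: "feasible \<xi> = (if \<kappa> = \<infinity> then \<Xi> \<inter> {\<xi>'. snd \<xi>' = snd \<xi>} else \<Xi>)"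
  using kappa_cases
  by (auto simp: feasible_def transport_cost_def xi_norm_def zero_ereal_def[symmetric])

lemma transport_cost_feasible:
  "\<xi>' \<in> feasible \<xi> \<Longrightarrow> transport_cost \<kappa> \<xi>' \<xi> = ereal (fin_cost \<xi>' \<xi>)"
  using kappa_cases
  by (auto simp: feasible_eq transport_cost_def xi_norm_def fin_cost_def zero_ereal_def[symmetric])

lemma dro_h_feasible:
  "\<xi>' \<in> feasible \<xi> \<Longrightarrow> dro_h f c \<kappa> \<rho> \<theta> \<gamma> \<xi> \<xi>' = ereal (fin_h \<theta> \<gamma> \<xi> \<xi>')"
  by (simp add: dro_h_def transport_cost_feasible fin_h_def)

lemma dro_h_infeasible:
  "\<xi>' \<in> \<Xi> \<Longrightarrow> \<xi>' \<notin> feasible \<xi> \<Longrightarrow> 0 < \<gamma> \<Longrightarrow> dro_h f c \<kappa> \<rho> \<theta> \<gamma> \<xi> \<xi>' = -\<infinity>"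
  by (simp add: dro_h_def feasible_def)

lemma feasible_subset: "feasible \<xi> \<subseteq> \<Xi>"
  by (auto simp: feasible_def)

lemma self_feasible: "\<xi> \<in> \<Xi> \<Longrightarrow> \<xi> \<in> feasible \<xi>"
  by (simp add: feasible_eq)

lemma fin_cost_nonneg: "0 \<le> fin_cost \<xi>' \<xi>"
  using kappa by (simp add: fin_cost_def real_of_ereal_pos)

text \<open>The feasible set is \<open>\<Xi>\<close> or a closed slice of it, hence compact, and the
  real-valued \<open>fin_h\<close> is continuous there; this covers \<kappa> = \<infinity> as
  well.\<close>

lemma ex_maximizer:
  assumes "\<theta> \<in> \<Theta>" "\<xi> \<in> \<Xi>"
  obtains \<xi>' where "\<xi>' \<in> feasible \<xi>" "\<And>\<zeta>. \<zeta> \<in> feasible \<xi> \<Longrightarrow> fin_h \<theta> \<gamma> \<xi> \<zeta> \<le> fin_h \<theta> \<gamma> \<xi> \<xi>'"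
proof -
  have "closed {\<xi>' :: (real^'p) \<times> (real^'m). snd \<xi>' = snd \<xi>}"
    by (intro closed_Collect_eq continuous_intros)
  then have "compact (feasible \<xi>)"
    using compact_\<Xi> by (simp add: feasible_eq compact_Int_closed)
  moreover have "continuous_on (feasible \<xi>) (fin_h \<theta> \<gamma> \<xi>)"
    unfolding fin_h_def fin_cost_def
    by (intro continuous_intros continuous_on_subset[OF loss_continuous[OF assms(1)] feasible_subset])
  ultimately show ?thesis
    using continuous_attains_sup[of "feasible \<xi>" "fin_h \<theta> \<gamma> \<xi>"] self_feasible[OF assms(2)] that by blast
qed

text \<open>Infeasible points have the value minus infinity, so the supremum over
  \<open>\<Xi>\<close> is the maximum over feasible points.\<close>

lemma h_star_maximizer:
  assumes "\<theta> \<in> \<Theta>" "0 < \<gamma>" "\<xi> \<in> \<Xi>"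
  obtains \<xi>' where "\<xi>' \<in> feasible \<xi>" "h_star \<theta> \<gamma> \<xi> = fin_h \<theta> \<gamma> \<xi> \<xi>'"
    "(SUP \<zeta>\<in>\<Xi>. dro_h f c \<kappa> \<rho> \<theta> \<gamma> \<xi> \<zeta>) = ereal (h_star \<theta> \<gamma> \<xi>)"
    "\<And>\<zeta>. \<zeta> \<in> feasible \<xi> \<Longrightarrow> fin_h \<theta> \<gamma> \<xi> \<zeta> \<le> h_star \<theta> \<gamma> \<xi>"
    "real_of_ereal (dro_h f c \<kappa> \<rho> \<theta> \<gamma> \<xi> (worst_case f c \<kappa> \<rho> \<Xi> \<theta> \<gamma> \<xi>)) = h_star \<theta> \<gamma> \<xi>"
proof -
  obtain \<xi>' where \<xi>': "\<xi>' \<in> feasible \<xi>" "\<And>\<zeta>. \<zeta> \<in> feasible \<xi> \<Longrightarrow> fin_h \<theta> \<gamma> \<xi> \<zeta> \<le> fin_h \<theta> \<gamma> \<xi> \<xi>'"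
    using ex_maximizer[OF assms(1,3)] by blast
  have in\<Xi>: "\<xi>' \<in> \<Xi>" using \<xi>'(1) feasible_subset by blast
  have le: "dro_h f c \<kappa> \<rho> \<theta> \<gamma> \<xi> \<zeta> \<le> dro_h f c \<kappa> \<rho> \<theta> \<gamma> \<xi> \<xi>'" if "\<zeta> \<in> \<Xi>" for \<zeta>
    using that \<xi>' assms(2) by (cases "\<zeta> \<in> feasible \<xi>") (auto simp: dro_h_feasible dro_h_infeasible)
  have sup: "(SUP \<zeta>\<in>\<Xi>. dro_h f c \<kappa> \<rho> \<theta> \<gamma> \<xi> \<zeta>) = dro_h f c \<kappa> \<rho> \<theta> \<gamma> \<xi> \<xi>'"
    using in\<Xi> le by (intro antisym SUP_least SUP_upper)
  \<comment> \<open>Whichever maximizer \<open>arg_max_on\<close> selects, its value is the maximum,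
    and the regret sees this value only.\<close>
  have wc: "dro_h f c \<kappa> \<rho> \<theta> \<gamma> \<xi> (worst_case f c \<kappa> \<rho> \<Xi> \<theta> \<gamma> \<xi>) = dro_h f c \<kappa> \<rho> \<theta> \<gamma> \<xi> \<xi>'"
    unfolding worst_case_def arg_max_on_def using in\<Xi> le by (rule arg_max_equality)
  have eq: "h_star \<theta> \<gamma> \<xi> = fin_h \<theta> \<gamma> \<xi> \<xi>'"
    unfolding dro_h_star_def sup by (simp add: dro_h_feasible \<xi>'(1))
  show ?thesis
    using \<xi>' sup wc eq by (intro that[of \<xi>']) (auto simp: dro_h_feasible)
qed

text \<open>The first-order inequality of the convex loss handles \<theta>; in \<gamma> the function
  is affine and contributes an equality.\<close>

lemma subgradient_le:
  assumes "\<theta> \<in> \<Theta>" "\<theta>' \<in> \<Theta>" "\<xi>' \<in> \<Xi>"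
  shows "subgradient \<theta> \<xi> \<xi>' \<bullet> ((\<theta>', \<gamma>') - (\<theta>, \<gamma>)) \<le> fin_h \<theta>' \<gamma>' \<xi> \<xi>' - fin_h \<theta> \<gamma> \<xi> \<xi>'"
  using convex_on_gradient_le[OF loss_convex[OF assms(3)] assms(1,2)
      GDERIV_grad[OF loss_differentiable[OF assms(1,3)]]]
  by (simp add: subgradient_def fin_h_def algebra_simps)

text \<open>An infeasible \<open>\<zeta>\<close> would have the value minus infinity, below a finite
  supremum minus \<epsilon>. Feasibility does not depend on the parameters, so
  \<open>\<zeta>\<close> competes in the maximization at (\<theta>', \<gamma>') too, and
  \<open>subgradient_le\<close> compares its two values.\<close>

lemma h_star_diff_le:
  assumes w: "\<theta> \<in> \<Theta>" "0 < \<gamma>" and w': "\<theta>' \<in> \<Theta>" "0 < \<gamma>'" and \<xi>: "\<xi> \<in> \<Xi>" and \<zeta>: "\<zeta> \<in> \<Xi>"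
    and approx: "(SUP \<xi>'\<in>\<Xi>. dro_h f c \<kappa> \<rho> \<theta> \<gamma> \<xi> \<xi>') - ereal \<epsilon> \<le> dro_h f c \<kappa> \<rho> \<theta> \<gamma> \<xi> \<zeta>"
  shows "\<zeta> \<in> feasible \<xi>"
    and "h_star \<theta> \<gamma> \<xi> - h_star \<theta>' \<gamma>' \<xi> \<le> \<epsilon> + subgradient \<theta> \<xi> \<zeta> \<bullet> ((\<theta>, \<gamma>) - (\<theta>', \<gamma>'))"
proof -
  have sup: "(SUP \<xi>'\<in>\<Xi>. dro_h f c \<kappa> \<rho> \<theta> \<gamma> \<xi> \<xi>') = ereal (h_star \<theta> \<gamma> \<xi>)"
    using h_star_maximizer[OF w \<xi>] by blast
  show feas: "\<zeta> \<in> feasible \<xi>"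
    using approx dro_h_infeasible[OF \<zeta> _ w(2)] by (cases "\<zeta> \<in> feasible \<xi>") (auto simp: sup)
  have "fin_h \<theta>' \<gamma>' \<xi> \<zeta> \<le> h_star \<theta>' \<gamma>' \<xi>"
    using h_star_maximizer[OF w' \<xi>] feas by blast
  moreover have "h_star \<theta> \<gamma> \<xi> - \<epsilon> \<le> fin_h \<theta> \<gamma> \<xi> \<zeta>"
    using approx by (simp add: sup dro_h_feasible[OF feas])
  moreover have "subgradient \<theta> \<xi> \<zeta> \<bullet> ((\<theta>', \<gamma>') - (\<theta>, \<gamma>)) = - (subgradient \<theta> \<xi> \<zeta> \<bullet> ((\<theta>, \<gamma>) - (\<theta>', \<gamma>')))"
    by (metis inner_minus_right minus_diff_eq)
  ultimately show "h_star \<theta> \<gamma> \<xi> - h_star \<theta>' \<gamma>' \<xi> \<le> \<epsilon> + subgradient \<theta> \<xi> \<zeta> \<bullet> ((\<theta>, \<gamma>) - (\<theta>', \<gamma>'))"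
    using subgradient_le[OF w(1) w'(1) \<zeta>, of \<xi> \<gamma>' \<gamma>] by linarith
qed

section \<open>Growth of the subgradients and of the worst-case value\<close>

lemma fin_cost_bounded: "\<exists>D\<ge>0. \<forall>\<xi>\<in>\<Xi>. \<forall>\<xi>'\<in>\<Xi>. fin_cost \<xi>' \<xi> \<le> D"
proof (intro exI conjI ballI)
  let ?k = "real_of_ereal \<kappa>"
  have k: "0 \<le> ?k" using kappa by (simp add: real_of_ereal_pos)
  have bdd: "bounded \<Xi>" using compact_\<Xi> by (rule compact_imp_bounded)
  show "0 \<le> diameter \<Xi> + ?k * diameter \<Xi>"
    using k diameter_ge_0[OF bdd] by simp
  fix \<xi> \<xi>' assume "\<xi> \<in> \<Xi>" "\<xi>' \<in> \<Xi>"
  then have "dist \<xi>' \<xi> \<le> diameter \<Xi>"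
    using diameter_bounded_bound[OF bdd] by simp
  then have "norm (fst \<xi>' - fst \<xi>) \<le> diameter \<Xi>" "norm (snd \<xi>' - snd \<xi>) \<le> diameter \<Xi>"
    using dist_fst_le[of \<xi>' \<xi>] dist_snd_le[of \<xi>' \<xi>] by (simp_all add: dist_norm)
  then show "fin_cost \<xi>' \<xi> \<le> diameter \<Xi> + ?k * diameter \<Xi>"
    unfolding fin_cost_def using k by (intro add_mono mult_left_mono) auto
qed

text \<open>If \<^term>\<open>\<kappa> = \<infinity>\<close>, Lipschitz continuity of the gradient in \<^term>\<open>\<xi>\<close> says nothing about
  points with different \<open>y\<close>-components. Instead, compactness bounds the loss for each fixed parameter,
  and convexity turns this into a bound on the directional derivatives.\<close>

lemma loss_grad_bounded_on_span:
  assumes \<theta>s: "\<theta>s \<in> \<Theta>"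
  shows "\<exists>B\<ge>0. \<forall>\<xi>\<in>\<Xi>. \<forall>v\<in>span ((\<lambda>\<theta>. \<theta> - \<theta>s) ` \<Theta>). \<bar>loss_grad \<theta>s \<xi> \<bullet> v\<bar> \<le> B * norm v"
proof -
  have loss_bdd: "\<exists>C. \<forall>\<xi>\<in>\<Xi>. \<bar>policy_loss f c \<theta> \<xi>\<bar> \<le> C" if "\<theta> \<in> \<Theta>" for \<theta>
    using compact_imp_bounded[OF compact_continuous_image[OF loss_continuous[OF that] compact_\<Xi>]]
    by (auto simp: bounded_iff)
  have "\<exists>B\<ge>0. \<forall>g\<in>loss_grad \<theta>s ` \<Xi>. \<forall>v\<in>span ((\<lambda>\<theta>. \<theta> - \<theta>s) ` \<Theta>). \<bar>g \<bullet> v\<bar> \<le> B * norm v"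
  proof (rule pointwise_bounded_on_span)
    fix v assume "v \<in> (\<lambda>\<theta>. \<theta> - \<theta>s) ` \<Theta>"
    then obtain \<theta> where \<theta>: "\<theta> \<in> \<Theta>" and v: "v = \<theta> - \<theta>s" by blast
    obtain C C' where C: "\<And>\<xi>. \<xi> \<in> \<Xi> \<Longrightarrow> \<bar>policy_loss f c \<theta> \<xi>\<bar> \<le> C"
      and C': "\<And>\<xi>. \<xi> \<in> \<Xi> \<Longrightarrow> \<bar>policy_loss f c \<theta>s \<xi>\<bar> \<le> C'"
      using loss_bdd[OF \<theta>] loss_bdd[OF \<theta>s] by blast
    \<comment> \<open>Convexity at \<open>\<theta>s\<close> bounds the product from above. Convexity
      at \<open>\<theta>\<close> gives a lower bound for the gradient there, and moving it to
      \<open>\<theta>s\<close> costs the Lipschitz term.\<close>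
    have "\<bar>loss_grad \<theta>s \<xi> \<bullet> v\<bar> \<le> C + C' + L * norm v * norm v" if \<xi>: "\<xi> \<in> \<Xi>" for \<xi>
    proof -
      have "loss_grad \<theta>s \<xi> \<bullet> (\<theta> - \<theta>s) \<le> policy_loss f c \<theta> \<xi> - policy_loss f c \<theta>s \<xi>"
        and "loss_grad \<theta> \<xi> \<bullet> (\<theta>s - \<theta>) \<le> policy_loss f c \<theta>s \<xi> - policy_loss f c \<theta> \<xi>"
        using convex_on_gradient_le[OF loss_convex[OF \<xi>]] \<theta> \<theta>s \<xi>
          GDERIV_grad[OF loss_differentiable] by blast+
      moreover have "(loss_grad \<theta> \<xi> - loss_grad \<theta>s \<xi>) \<bullet> v \<le> L * norm v * norm v"
        using norm_cauchy_schwarz[of "loss_grad \<theta> \<xi> - loss_grad \<theta>s \<xi>" v]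
          mult_right_mono[OF grad_lipschitz[OF \<theta> \<theta>s \<xi>], of "norm v"]
        by (simp add: v)
      moreover have "0 \<le> L * norm v * norm v" using L_nonneg by simp
      ultimately show ?thesis
        using C[OF \<xi>] C'[OF \<xi>] by (simp add: v inner_diff_left inner_diff_right)
    qed
    then show "\<exists>K. \<forall>g\<in>loss_grad \<theta>s ` \<Xi>. \<bar>g \<bullet> v\<bar> \<le> K" by blast
  qed
  then show ?thesis by blast
qed

text \<open>The loss gradient is its value at \<open>\<theta>s\<close>, bounded along the span, plus
  an increment controlled by the Lipschitz constant. The \<gamma>-component is bounded because
  transport costs on the compact \<open>\<Xi>\<close> are.\<close>

lemma subgradient_growth:
  assumes \<theta>s: "\<theta>s \<in> \<Theta>"
  shows "\<exists>B\<ge>0. \<forall>\<theta>\<in>\<Theta>. \<forall>\<gamma> \<gamma>s. \<forall>\<xi>\<in>\<Xi>. \<forall>\<xi>'\<in>feasible \<xi>.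
    \<forall>v. fst v \<in> span ((\<lambda>\<theta>. \<theta> - \<theta>s) ` \<Theta>) \<longrightarrow>
      \<bar>subgradient \<theta> \<xi> \<xi>' \<bullet> v\<bar> \<le> (B + L * norm ((\<theta>, \<gamma>) - (\<theta>s, \<gamma>s))) * norm v"
proof -
  obtain B where B: "B \<ge> 0" "\<And>\<xi> v. \<xi> \<in> \<Xi> \<Longrightarrow> v \<in> span ((\<lambda>\<theta>. \<theta> - \<theta>s) ` \<Theta>) \<Longrightarrow> \<bar>loss_grad \<theta>s \<xi> \<bullet> v\<bar> \<le> B * norm v"
    using loss_grad_bounded_on_span[OF \<theta>s] by blast
  obtain D where D: "D \<ge> 0" "\<And>\<xi> \<xi>'. \<xi> \<in> \<Xi> \<Longrightarrow> \<xi>' \<in> \<Xi> \<Longrightarrow> fin_cost \<xi>' \<xi> \<le> D"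
    using fin_cost_bounded by blast
  show ?thesis
  proof (intro exI[of _ "B + (\<rho> + D)"] conjI ballI allI impI)
    fix \<theta> \<gamma> \<gamma>s \<xi> \<xi>' and v :: "(real^'k) \<times> real"
    assume \<theta>: "\<theta> \<in> \<Theta>" and \<xi>: "\<xi> \<in> \<Xi>" and "\<xi>' \<in> feasible \<xi>"
      and v: "fst v \<in> span ((\<lambda>\<theta>. \<theta> - \<theta>s) ` \<Theta>)"
    then have \<xi>': "\<xi>' \<in> \<Xi>" using feasible_subset by blast
    have v_le: "norm (fst v) \<le> norm v" "\<bar>snd v\<bar> \<le> norm v"
      using norm_fst_le[of "fst v" "snd v"] norm_snd_le[of "snd v" "fst v"] by simp_all
    let ?r = "norm ((\<theta>, \<gamma>) - (\<theta>s, \<gamma>s))"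
    have r: "norm (\<theta> - \<theta>s) \<le> ?r"
      using norm_fst_le[of "\<theta> - \<theta>s" "\<gamma> - \<gamma>s"] by simp
    have "\<bar>(loss_grad \<theta> \<xi>' - loss_grad \<theta>s \<xi>') \<bullet> fst v\<bar> \<le> (L * ?r) * norm v"
      using Cauchy_Schwarz_ineq2[of "loss_grad \<theta> \<xi>' - loss_grad \<theta>s \<xi>'" "fst v"]
        mult_mono[OF order_trans[OF grad_lipschitz[OF \<theta> \<theta>s \<xi>'] mult_left_mono[OF r L_nonneg]] v_le(1)] L_nonneg
      by simp
    moreover have "\<bar>loss_grad \<theta>s \<xi>' \<bullet> fst v\<bar> \<le> B * norm v"
      using B(2)[OF \<xi>' v] mult_left_mono[OF v_le(1) B(1)] by linarith
    moreover have "\<bar>(\<rho> - fin_cost \<xi>' \<xi>) * snd v\<bar> \<le> (\<rho> + D) * norm v"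
      unfolding abs_mult using D(2)[OF \<xi> \<xi>'] fin_cost_nonneg[of \<xi>' \<xi>] rho D(1) v_le(2)
      by (intro mult_mono) auto
    moreover have "subgradient \<theta> \<xi> \<xi>' \<bullet> v = (loss_grad \<theta> \<xi>' - loss_grad \<theta>s \<xi>') \<bullet> fst v
        + loss_grad \<theta>s \<xi>' \<bullet> fst v + (\<rho> - fin_cost \<xi>' \<xi>) * snd v"
      by (simp add: subgradient_def inner_prod_def inner_diff_left)
    ultimately show "\<bar>subgradient \<theta> \<xi> \<xi>' \<bullet> v\<bar> \<le> (B + (\<rho> + D) + L * ?r) * norm v"
      by (simp add: distrib_right)
  qed (use B(1) D(1) rho in auto)
qed

end

lemma (in prob_space) indep_set_subset:
  assumes "indep_set A B" "A' \<subseteq> A" "B' \<subseteq> B"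
  shows "indep_set A' B'"
  using assms unfolding indep_sets2_eq by blast

context convex_dro
begin

text \<open>An exact maximizer is admissible in \<open>h_star_diff_le\<close> with \<epsilon> = 0;
  the inequality is applied in both directions. The result supplies the domination needed for the
  expectations along a run.\<close>

lemma abs_h_star_diff_le:
  assumes \<theta>s: "\<theta>s \<in> \<Theta>" "0 < \<gamma>s" and \<theta>: "\<theta> \<in> \<Theta>" "0 < \<gamma>" and \<xi>: "\<xi> \<in> \<Xi>" and B: "0 \<le> B"
    and growth: "\<And>\<theta> \<gamma> \<xi> \<xi>' v. \<theta> \<in> \<Theta> \<Longrightarrow> \<xi> \<in> \<Xi> \<Longrightarrow> \<xi>' \<in> feasible \<xi> \<Longrightarrow>
      fst v \<in> span ((\<lambda>\<theta>. \<theta> - \<theta>s) ` \<Theta>) \<Longrightarrow>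
      \<bar>subgradient \<theta> \<xi> \<xi>' \<bullet> v\<bar> \<le> (B + L * norm ((\<theta>, \<gamma>) - (\<theta>s, \<gamma>s))) * norm v"
  shows "\<bar>h_star \<theta> \<gamma> \<xi> - h_star \<theta>s \<gamma>s \<xi>\<bar>
    \<le> (B + L * norm ((\<theta>, \<gamma>) - (\<theta>s, \<gamma>s))) * norm ((\<theta>, \<gamma>) - (\<theta>s, \<gamma>s))"
proof -
  let ?v = "(\<theta>, \<gamma>) - (\<theta>s, \<gamma>s)" and ?v' = "(\<theta>s, \<gamma>s) - (\<theta>, \<gamma>)"
  have span: "fst ?v \<in> span ((\<lambda>\<theta>. \<theta> - \<theta>s) ` \<Theta>)" "fst ?v' \<in> span ((\<lambda>\<theta>. \<theta> - \<theta>s) ` \<Theta>)"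
    using \<theta> span_neg[OF span_base[of "\<theta> - \<theta>s" "(\<lambda>\<theta>. \<theta> - \<theta>s) ` \<Theta>"]]
    by (auto intro: span_base)
  have bound: "h_star \<theta>1 \<gamma>1 \<xi> - h_star \<theta>2 \<gamma>2 \<xi>
      \<le> (B + L * norm ((\<theta>1, \<gamma>1) - (\<theta>s, \<gamma>s))) * norm ((\<theta>1, \<gamma>1) - (\<theta>2, \<gamma>2))"
    if 1: "\<theta>1 \<in> \<Theta>" "0 < \<gamma>1" and 2: "\<theta>2 \<in> \<Theta>" "0 < \<gamma>2"
      and span: "fst ((\<theta>1, \<gamma>1) - (\<theta>2, \<gamma>2)) \<in> span ((\<lambda>\<theta>. \<theta> - \<theta>s) ` \<Theta>)" for \<theta>1 \<gamma>1 \<theta>2 \<gamma>2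
  proof -
    obtain \<zeta> where \<zeta>: "\<zeta> \<in> feasible \<xi>" "h_star \<theta>1 \<gamma>1 \<xi> = fin_h \<theta>1 \<gamma>1 \<xi> \<zeta>"
      and sup: "(SUP \<zeta>\<in>\<Xi>. dro_h f c \<kappa> \<rho> \<theta>1 \<gamma>1 \<xi> \<zeta>) = ereal (h_star \<theta>1 \<gamma>1 \<xi>)"
      using h_star_maximizer[OF 1 \<xi>] by blast
    have "h_star \<theta>1 \<gamma>1 \<xi> - h_star \<theta>2 \<gamma>2 \<xi> \<le> 0 + subgradient \<theta>1 \<xi> \<zeta> \<bullet> ((\<theta>1, \<gamma>1) - (\<theta>2, \<gamma>2))"
      using \<zeta> feasible_subset[of \<xi>]
      by (intro h_star_diff_le(2)[OF 1 2 \<xi>]) (auto simp: sup dro_h_feasible)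
    then show ?thesis
      using growth[OF 1(1) \<xi> \<zeta>(1) span, of \<gamma>1] by linarith
  qed
  have "h_star \<theta> \<gamma> \<xi> - h_star \<theta>s \<gamma>s \<xi> \<le> (B + L * norm ?v) * norm ?v"
    using bound[OF \<theta> \<theta>s span(1)] .
  \<comment> \<open>Here the subgradient is taken at \<open>(\<theta>s, \<gamma>s)\<close> itself,
    where the distance term vanishes.\<close>
  moreover have "h_star \<theta>s \<gamma>s \<xi> - h_star \<theta> \<gamma> \<xi> \<le> B * norm ?v"
    using bound[OF \<theta>s \<theta> span(2)] norm_minus_commute[of "(\<theta>, \<gamma>)" "(\<theta>s, \<gamma>s)"]
    by (simp del: diff_Pair)
  moreover have "B * norm ?v \<le> (B + L * norm ?v) * norm ?v"
    using L_nonneg by (intro mult_right_mono) auto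
  ultimately show ?thesis by linarith
qed

section \<open>Expected regret along a run\<close>

text \<open>\<open>K\<close> is chosen before \<open>T\<close>, \<open>s\<close> and the run. The
  lower bound 0 is recorded so that the average regret can later be bounded in absolute
  value.\<close>

lemma online_regret_bound:
  fixes Q :: "((real^'p) \<times> (real^'m)) measure"
  assumes Q: "sets Q = sets borel"
    and h_star_continuous: "\<And>\<xi>. \<xi> \<in> \<Xi> \<Longrightarrow> continuous_on (\<Theta> \<times> {0<..}) (\<lambda>w. h_star (fst w) (snd w) \<xi>)"
    and h_star_integrable: "\<And>\<theta> \<gamma>. \<theta> \<in> \<Theta> \<Longrightarrow> 0 < \<gamma> \<Longrightarrow> integrable Q (h_star \<theta> \<gamma>)"
    and \<theta>s: "\<theta>s \<in> \<Theta>" "0 < \<gamma>s"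
    and minimizer: "\<And>\<theta> \<gamma>. \<theta> \<in> \<Theta> \<Longrightarrow> 0 < \<gamma> \<Longrightarrow> dro_H f c \<kappa> \<rho> \<Xi> Q \<theta>s \<gamma>s \<le> dro_H f c \<kappa> \<rho> \<Xi> Q \<theta> \<gamma>"
    and a: "0 < a" and q: "0 \<le> q"
  shows "\<exists>K. \<forall>T\<ge>1. \<forall>s\<le>1. \<forall>(M :: 'w measure) \<theta> \<gamma> \<xi> \<zeta>.
    online_da_sgd_run f c \<kappa> \<rho> \<Theta> \<Xi> Q (a / sqrt (real T)) (a / sqrt (real T)) (q / sqrt (real T))
      \<theta>0 \<gamma>0 s T M \<theta> \<gamma> \<xi> \<zeta> \<longrightarrow>
    integrable M (regret f c \<kappa> \<rho> \<Xi> T \<theta> \<gamma> \<xi> \<theta>s \<gamma>s) \<and>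
    0 \<le> (\<integral>\<omega>. regret f c \<kappa> \<rho> \<Xi> T \<theta> \<gamma> \<xi> \<theta>s \<gamma>s \<omega> \<partial>M) \<and>
    (\<integral>\<omega>. regret f c \<kappa> \<rho> \<Xi> T \<theta> \<gamma> \<xi> \<theta>s \<gamma>s \<omega> \<partial>M) \<le> K * sqrt (real T)"
proof -
  define S where "S = span ((\<lambda>\<theta>. \<theta> - \<theta>s) ` \<Theta>)"
  define ws where "ws = (\<theta>s, \<gamma>s)"
  obtain B where B: "B \<ge> 0" and growth: "\<And>\<theta> \<gamma> \<xi> \<xi>' v. \<theta> \<in> \<Theta> \<Longrightarrow> \<xi> \<in> \<Xi> \<Longrightarrow> \<xi>' \<in> feasible \<xi> \<Longrightarrow> fst v \<in> S \<Longrightarrow>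
      \<bar>subgradient \<theta> \<xi> \<xi>' \<bullet> v\<bar> \<le> (B + L * norm ((\<theta>, \<gamma>) - ws)) * norm v"
    using subgradient_growth[OF \<theta>s(1)] unfolding S_def ws_def by blast
  have h_star_growth: "\<bar>h_star \<theta> \<gamma> \<xi> - h_star \<theta>s \<gamma>s \<xi>\<bar> \<le> (B + L * norm ((\<theta>, \<gamma>) - ws)) * norm ((\<theta>, \<gamma>) - ws)"
    if "\<theta> \<in> \<Theta>" "0 < \<gamma>" "\<xi> \<in> \<Xi>" for \<theta> \<gamma> \<xi>
    unfolding ws_def
    by (rule abs_h_star_diff_le[OF \<theta>s that B]) (use growth in \<open>auto simp: S_def ws_def\<close>)
  \<comment> \<open>\<open>b\<close> and \<open>c0\<close> are the coefficients of the descent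
    inequality after the factor \<open>1 / T\<close> has been split off; \<open>E\<close> is the
    resulting Gronwall bound.\<close>
  define b where "b = 2 * L\<^sup>2 * a\<^sup>2"
  define c0 where "c0 = 2 * a * q + 2 * a\<^sup>2 * B\<^sup>2"
  define E where "E = exp b * ((norm ((\<theta>0, \<gamma>0) - ws))\<^sup>2 + c0)"
  have b: "0 \<le> b" and c0: "0 \<le> c0" using a q by (simp_all add: b_def c0_def)
  have E: "0 \<le> E" using c0 by (simp add: E_def)
  \<comment> \<open>The first summand pays for the rounds before \<open>T\<close>, the second for
    round \<open>T\<close>.\<close>
  define K where "K = E / (2 * a) + (q + B\<^sup>2 + (1 + L) * E)"
  show ?thesis
  proof (intro exI[of _ K] allI impI)
    fix T s :: nat and M :: "'w measure" and \<theta> \<gamma> \<xi> \<zeta>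
    assume T: "1 \<le> T" and s: "s \<le> 1"
      and run: "online_da_sgd_run f c \<kappa> \<rho> \<Theta> \<Xi> Q (a / sqrt (real T)) (a / sqrt (real T))
        (q / sqrt (real T)) \<theta>0 \<gamma>0 s T M \<theta> \<gamma> \<xi> \<zeta>"
    define \<alpha> where "\<alpha> = a / sqrt (real T)"
    define \<epsilon> where "\<epsilon> = q / sqrt (real T)"
    note run = run[unfolded online_da_sgd_run_def, folded \<alpha>_def \<epsilon>_def]
    have \<alpha>: "0 < \<alpha>" and \<epsilon>: "0 \<le> \<epsilon>" using a q T by (simp_all add: \<alpha>_def \<epsilon>_def)
    interpret prob_space M using run by blast
    define w where "w t \<omega> = (\<theta> t \<omega>, \<gamma> t \<omega>)" for t \<omega>
    define r where "r t \<omega> = h_star (\<theta> t \<omega>) (\<gamma> t \<omega>) (\<xi> t \<omega>) - h_star \<theta>s \<gamma>s (\<xi> t \<omega>)" for t \<omega>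
    define g where "g t \<omega> = subgradient (\<theta> t \<omega>) (\<xi> t \<omega>) (\<zeta> t \<omega>)" for t \<omega>
    define x where "x t \<omega> = norm (w t \<omega> - ws)" for t \<omega>
    have x_nonneg: "0 \<le> x t \<omega>" for t \<omega> by (simp add: x_def)
    have in_dom: "\<theta> t \<omega> \<in> \<Theta>" "0 < \<gamma> t \<omega>" "\<xi> t \<omega> \<in> \<Xi>" "\<zeta> t \<omega> \<in> \<Xi>"
      if "t \<in> {s..T}" "\<omega> \<in> space M" for t \<omega>
      using run that by blast+
    have feas: "\<zeta> t \<omega> \<in> feasible (\<xi> t \<omega>)"
      and r_le: "r t \<omega> \<le> \<epsilon> + g t \<omega> \<bullet> (w t \<omega> - ws)" if "t \<in> {s..T}" "\<omega> \<in> space M" for t \<omega>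
      using h_star_diff_le[OF in_dom(1,2)[OF that] \<theta>s in_dom(3,4)[OF that], of \<epsilon>] run that
      unfolding r_def g_def w_def ws_def by blast+
    have in_S: "fst (w t \<omega> - ws) \<in> S" if "t \<in> {s..T}" "\<omega> \<in> space M" for t \<omega>
      using in_dom(1)[OF that] by (auto simp: w_def ws_def S_def intro: span_base)
    have g_growth: "\<bar>g t \<omega> \<bullet> v\<bar> \<le> (B + L * x t \<omega>) * norm v"
      if "t \<in> {s..T}" "\<omega> \<in> space M" "fst v \<in> S" for t \<omega> v
      using growth[OF in_dom(1,3)[OF that(1,2)] feas[OF that(1,2)] that(3)]
      by (simp add: g_def x_def w_def)
    \<comment> \<open>Feasibility of \<open>\<zeta>\<close> turns the extended transport cost into
      \<open>fin_cost\<close>, and equal step sizes merge the two updates into one.\<close>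
    have update: "w (Suc t) \<omega> = w t \<omega> - \<alpha> *\<^sub>R g t \<omega>" if "t \<in> {s..T}" "\<omega> \<in> space M" for t \<omega>
    proof -
      have "\<theta> (Suc t) \<omega> = \<theta> t \<omega> - \<alpha> *\<^sub>R loss_grad (\<theta> t \<omega>) (\<zeta> t \<omega>)"
        "\<gamma> (Suc t) \<omega> = \<gamma> t \<omega> - \<alpha> * (\<rho> - real_of_ereal (transport_cost \<kappa> (\<zeta> t \<omega>) (\<xi> t \<omega>)))"
        using run that by blast+
      then show ?thesis
        by (simp add: w_def g_def subgradient_def transport_cost_feasible[OF feas[OF that]])
    qed
    text \<open>Both iterates lie in \<^term>\<open>\<Theta>\<close>, so the step direction lies in the controlled span.\<close>
    have g_norm: "norm (g t \<omega>) \<le> B + L * x t \<omega>" if t: "t \<in> {s..<T}" and \<omega>: "\<omega> \<in> space M" for t \<omega>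
    proof -
      have tT: "t \<in> {s..T}" "Suc t \<in> {s..T}" using t by auto
      have "g t \<omega> = (1 / \<alpha>) *\<^sub>R ((w t \<omega> - ws) - (w (Suc t) \<omega> - ws))"
        using update[OF tT(1) \<omega>] \<alpha> by simp
      then have "fst (g t \<omega>) = (1 / \<alpha>) *\<^sub>R (fst (w t \<omega> - ws) - fst (w (Suc t) \<omega> - ws))"
        by simp
      then have "fst (g t \<omega>) \<in> S"
        using in_S[OF tT(1) \<omega>] in_S[OF tT(2) \<omega>] unfolding S_def by (metis span_diff span_scale)
      \<comment> \<open>The growth bound is tested against the subgradient itself; one factor of its
        norm then cancels.\<close>
      then have "norm (g t \<omega>) * norm (g t \<omega>) \<le> (B + L * x t \<omega>) * norm (g t \<omega>)"
        using g_growth[OF tT(1) \<omega>, of "g t \<omega>"] by (simp add: dot_square_norm power2_eq_square)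
      then show ?thesis
        using B L_nonneg x_nonneg[of t \<omega>] by (cases "g t \<omega> = 0") auto
    qed
    have descent: "(x (Suc t) \<omega>)\<^sup>2 \<le> (1 + 2 * L\<^sup>2 * \<alpha>\<^sup>2) * (x t \<omega>)\<^sup>2 + (2 * \<alpha> * \<epsilon> + 2 * \<alpha>\<^sup>2 * B\<^sup>2) - 2 * \<alpha> * r t \<omega>"
      if t: "t \<in> {s..<T}" and \<omega>: "\<omega> \<in> space M" for t \<omega>
    proof -
      have tT: "t \<in> {s..T}" using t by auto
      have "(x (Suc t) \<omega>)\<^sup>2 = (x t \<omega>)\<^sup>2 - 2 * \<alpha> * (g t \<omega> \<bullet> (w t \<omega> - ws)) + \<alpha>\<^sup>2 * (norm (g t \<omega>))\<^sup>2"
      proof -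
        have eq: "w (Suc t) \<omega> - ws = (w t \<omega> - ws) - \<alpha> *\<^sub>R g t \<omega>" using update[OF tT \<omega>] by simp
        show ?thesis
          unfolding x_def eq dot_square_norm[symmetric]
          by (simp add: inner_diff_left inner_diff_right inner_commute power2_eq_square algebra_simps)
      qed
      also have "\<dots> \<le> (x t \<omega>)\<^sup>2 + 2 * \<alpha> * (\<epsilon> - r t \<omega>) + \<alpha>\<^sup>2 * (2 * B\<^sup>2 + 2 * L\<^sup>2 * (x t \<omega>)\<^sup>2)"
      proof -
        have "2 * \<alpha> * (r t \<omega> - \<epsilon>) \<le> 2 * \<alpha> * (g t \<omega> \<bullet> (w t \<omega> - ws))"
          using r_le[OF tT \<omega>] \<alpha> by (intro mult_left_mono) auto
        moreover have "(norm (g t \<omega>))\<^sup>2 \<le> 2 * B\<^sup>2 + 2 * L\<^sup>2 * (x t \<omega>)\<^sup>2"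
        proof -
          have "(norm (g t \<omega>))\<^sup>2 \<le> (B + L * x t \<omega>)\<^sup>2"
            using g_norm[OF t \<omega>] by (intro power_mono) auto
          also have "\<dots> \<le> 2 * B\<^sup>2 + 2 * L\<^sup>2 * (x t \<omega>)\<^sup>2"
            using zero_le_power2[of "B - L * x t \<omega>"]
            by (simp add: power2_eq_square algebra_simps)
          finally show ?thesis .
        qed
        then have "\<alpha>\<^sup>2 * (norm (g t \<omega>))\<^sup>2 \<le> \<alpha>\<^sup>2 * (2 * B\<^sup>2 + 2 * L\<^sup>2 * (x t \<omega>)\<^sup>2)"
          by (intro mult_left_mono) auto
        ultimately show ?thesis by (simp add: algebra_simps)
      qed
      finally show ?thesis by (simp add: algebra_simps)
    qed
    have start: "x s \<omega> = norm ((\<theta>0, \<gamma>0) - ws)" if "\<omega> \<in> space M" for \<omega>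
      using run that by (simp add: x_def w_def)
    \<comment> \<open>The start is deterministic and each step is bounded in terms of the current
      distance. These radii depend on \<open>t\<close>; they justify integrability and domination
      and do not enter \<open>K\<close>.\<close>
    have bounded: "\<exists>R\<ge>0. \<forall>\<omega>\<in>space M. x t \<omega> \<le> R" if "t \<in> {s..T}" for t
    proof -
      have "s \<le> t" using that by simp
      then show ?thesis
        using that
      proof (induction t rule: dec_induct)
        case base
        then show ?case using start by (intro exI[of _ "norm ((\<theta>0, \<gamma>0) - ws)"]) auto
      next
        case (step n)
        then obtain R where R: "0 \<le> R" "\<And>\<omega>. \<omega> \<in> space M \<Longrightarrow> x n \<omega> \<le> R" by auto
        have "x (Suc n) \<omega> \<le> R + \<alpha> * (B + L * R)" if \<omega>: "\<omega> \<in> space M" for \<omega>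
        proof -
          have "w (Suc n) \<omega> - ws = (w n \<omega> - ws) - \<alpha> *\<^sub>R g n \<omega>"
            using update[of n \<omega>] step \<omega> by simp
          then have "x (Suc n) \<omega> \<le> x n \<omega> + norm (\<alpha> *\<^sub>R g n \<omega>)"
            unfolding x_def by (metis norm_triangle_ineq4)
          also have "norm (\<alpha> *\<^sub>R g n \<omega>) \<le> \<alpha> * (B + L * R)"
            using g_norm[of n \<omega>] step \<omega> \<alpha> mult_left_mono[OF R(2)[OF \<omega>] L_nonneg] by simp
          finally show ?thesis using R(2)[OF \<omega>] by simp
        qed
        moreover have "0 \<le> R + \<alpha> * (B + L * R)" using R(1) \<alpha> B L_nonneg by simp
        ultimately show ?case by blast
      qed
    qed
    have w_meas: "w t \<in> borel_measurable M" if "t \<in> {s..T}" for t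
    proof -
      have "\<theta> t \<in> borel_measurable M" "\<gamma> t \<in> borel_measurable M" using run that by blast+
      then show ?thesis unfolding w_def by (rule borel_measurable_Pair)
    qed
    have x2_integrable: "integrable M (\<lambda>\<omega>. (x t \<omega>)\<^sup>2)" if t: "t \<in> {s..T}" for t
    proof -
      obtain R where R: "\<And>\<omega>. \<omega> \<in> space M \<Longrightarrow> x t \<omega> \<le> R" using bounded[OF t] by blast
      have [measurable]: "w t \<in> borel_measurable M" using w_meas[OF t] .
      show ?thesis
        by (rule integrable_const_bound[of _ "R\<^sup>2"])
          (auto simp: x_def intro!: power_mono R[unfolded x_def])
    qed
    have r_integrable: "integrable M (r t)" and r_nonneg: "0 \<le> expectation (r t)"
      if t: "t \<in> {s..T}" for t
    proof -
      obtain R where R: "0 \<le> R" "\<And>\<omega>. \<omega> \<in> space M \<Longrightarrow> x t \<omega> \<le> R" using bounded[OF t] by blast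
      \<comment> \<open>Cutting the parameter domain down to a ball makes \<open>F\<close> bounded
        without losing any value of \<open>w t\<close>.\<close>
      define W where "W = (\<Theta> \<times> {0<..}) \<inter> {w. norm (w - ws) \<le> R}"
      define F where "F w y = h_star (fst w) (snd w) y - h_star \<theta>s \<gamma>s y" for w y
      define \<Phi> where "\<Phi> \<omega> = (\<lambda>j\<in>{s..t}. (\<theta> j \<omega>, \<gamma> j \<omega>), \<lambda>j\<in>{s..<t}. (\<xi> j \<omega>, \<zeta> j \<omega>))" for \<omega>
      have \<xi>_meas: "\<xi> t \<in> borel_measurable M" and distr: "distr M borel (\<xi> t) = Q"
        using run t by blast+
      \<comment> \<open>The current iterate is the last coordinate of the iterate history in
        \<open>\<Phi>\<close>, so it inherits independence from the new sample.\<close>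
      have past: "sets (vimage_algebra (space M) (w t) borel) \<subseteq>
        sets (vimage_algebra (space M) \<Phi> (PiM {s..t} (\<lambda>_. borel) \<Otimes>\<^sub>M PiM {s..<t} (\<lambda>_. borel)))"
      proof -
        have "(\<lambda>\<omega>. fst (\<Phi> \<omega>) t) = w t" using t by (auto simp: \<Phi>_def w_def)
        moreover have "\<Phi> \<in> space M \<rightarrow> space (PiM {s..t} (\<lambda>_. borel) \<Otimes>\<^sub>M PiM {s..<t} (\<lambda>_. borel))"
          by (auto simp: \<Phi>_def space_pair_measure space_PiM)
        moreover have "(\<lambda>p. fst p t) \<in> borel_measurable (PiM {s..t} (\<lambda>_. borel) \<Otimes>\<^sub>M PiM {s..<t} (\<lambda>_. borel))"
          using t by (intro measurable_compose[OF measurable_fst] measurable_component_singleton) auto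
        ultimately show ?thesis
          using sets_vimage_algebra_comp_subset[where X=\<Phi> and g="\<lambda>p. fst p t" and K=borel] by metis
      qed
      have indep: "indep_set (sets (vimage_algebra (space M) (w t) borel))
        (sets (vimage_algebra (space M) (\<xi> t) borel))"
        by (rule indep_set_subset[OF _ past]) (use run t in \<open>auto simp: \<Phi>_def[abs_def]\<close>)
      have F_meas: "F w \<in> borel_measurable borel" and F_int: "integrable Q (F w)"
        and F_nonneg: "0 \<le> integral\<^sup>L Q (F w)" if "w \<in> W" for w
      proof -
        have int: "integrable Q (h_star (fst w) (snd w))" "integrable Q (h_star \<theta>s \<gamma>s)"
          using that \<theta>s by (auto simp: W_def intro!: h_star_integrable)
        then show "integrable Q (F w)" unfolding F_def by auto
        then show "F w \<in> borel_measurable borel"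
          using borel_measurable_integrable measurable_cong_sets[OF Q refl] by blast
        \<comment> \<open>For a fixed parameter the integral is the difference of two values of
          \<open>dro_H\<close>, and the subtracted one is minimal.\<close>
        show "0 \<le> integral\<^sup>L Q (F w)"
          using minimizer[of "fst w" "snd w"] that int by (auto simp: W_def F_def[abs_def] dro_H_def)
      qed
      have w_in: "w t \<omega> \<in> W" and F_cont: "continuous_on W (\<lambda>w. F w (\<xi> t \<omega>))"
        if \<omega>: "\<omega> \<in> space M" for \<omega>
      proof -
        show "w t \<omega> \<in> W" using R(2)[OF \<omega>] in_dom[OF t \<omega>] by (simp add: W_def w_def x_def)
        show "continuous_on W (\<lambda>w. F w (\<xi> t \<omega>))"
          unfolding F_def using h_star_continuous[OF in_dom(3)[OF t \<omega>]]
          by (intro continuous_intros) (auto simp: W_def elim: continuous_on_subset)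
      qed
      have F_bdd: "\<bar>F v (\<xi> t \<omega>)\<bar> \<le> (B + L * R) * R" if v: "v \<in> W" and \<omega>: "\<omega> \<in> space M" for v \<omega>
      proof -
        have "\<bar>F v (\<xi> t \<omega>)\<bar> \<le> (B + L * norm (v - ws)) * norm (v - ws)"
          using h_star_growth[of "fst v" "snd v", OF _ _ in_dom(3)[OF t \<omega>]] v
          by (auto simp: W_def F_def)
        also have "\<dots> \<le> (B + L * R) * R"
          using v B R(1) L_nonneg by (intro mult_mono add_mono mult_left_mono) (auto simp: W_def)
        finally show ?thesis .
      qed
      have F_exp: "0 \<le> expectation (\<lambda>\<omega>. F v (\<xi> t \<omega>))" if v: "v \<in> W" for v
        using F_nonneg[OF v] integral_distr[OF \<xi>_meas F_meas[OF v]] by (simp add: distr)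
      note expectation_indep_nonneg[where F=F,
          OF w_meas[OF t] \<xi>_meas indep w_in F_meas F_cont F_bdd F_exp]
      then show "integrable M (r t)" "0 \<le> expectation (r t)"
        by (auto simp: F_def w_def r_def[abs_def])
    qed
    define e where "e t = expectation (\<lambda>\<omega>. (x t \<omega>)\<^sup>2)" for t
    have sqrtT: "0 < sqrt (real T)" "1 \<le> sqrt (real T)" using T by simp_all
    have recursion: "e (Suc t) \<le> (1 + b / real T) * e t + c0 / real T - (2 * \<alpha>) * expectation (r t)"
      if t: "t \<in> {s..<T}" for t
    proof -
      have tT: "t \<in> {s..T}" "Suc t \<in> {s..T}" using t by auto
      \<comment> \<open>Step size and tolerance both scale like \<open>1 / sqrt T\<close>, so every
        error term is of order \<open>1 / T\<close>.\<close>
      have coeff: "2 * L\<^sup>2 * \<alpha>\<^sup>2 = b / real T" "2 * \<alpha> * \<epsilon> + 2 * \<alpha>\<^sup>2 * B\<^sup>2 = c0 / real T"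
        using T by (simp_all add: \<alpha>_def \<epsilon>_def b_def c0_def power_divide add_divide_distrib)
      have "e (Suc t) \<le> expectation (\<lambda>\<omega>. (1 + b / real T) * (x t \<omega>)\<^sup>2 + c0 / real T - 2 * \<alpha> * r t \<omega>)"
        unfolding e_def using descent[OF t] unfolding coeff
        using x2_integrable[OF tT(1)] x2_integrable[OF tT(2)] r_integrable[OF tT(1)]
        by (intro integral_mono) auto
      also have "\<dots> = (1 + b / real T) * e t + c0 / real T - (2 * \<alpha>) * expectation (r t)"
        unfolding e_def using x2_integrable[OF tT(1)] r_integrable[OF tT(1)]
        by (simp add: prob_space)
      finally show ?thesis .
    qed
    \<comment> \<open>The number of updates whose result is still an iterate with index at most
      \<open>T\<close>.\<close>
    define n where "n = T - s"
    have sn: "s + n = T" using s T by (simp add: n_def)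
    have "e (s + n) + (2 * \<alpha>) * (\<Sum>j<n. expectation (r (s + j))) \<le> exp b * (e (s + 0) + c0)"
    proof (rule discrete_gronwall_regret[where T=T])
      show "0 \<le> expectation (r (s + j))" if "j < n" for j
        using that sn by (intro r_nonneg) auto
      show "e (s + Suc j) \<le> (1 + b / real T) * e (s + j) + c0 / real T - 2 * \<alpha> * expectation (r (s + j))"
        if "j < n" for j
        using recursion[of "s + j"] that sn by simp
    qed (use T \<alpha> b c0 sn in \<open>auto simp: e_def\<close>)
    moreover have "e s = (norm ((\<theta>0, \<gamma>0) - ws))\<^sup>2"
    proof -
      have "e s = expectation (\<lambda>\<omega>. (norm ((\<theta>0, \<gamma>0) - ws))\<^sup>2)"
        unfolding e_def by (rule Bochner_Integration.integral_cong) (simp_all add: start)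
      then show ?thesis by (simp add: prob_space)
    qed
    ultimately have main: "e T + (2 * \<alpha>) * (\<Sum>j<n. expectation (r (s + j))) \<le> E"
      by (simp add: E_def sn)
    have partial: "(\<Sum>t\<in>{1..<T}. expectation (r t)) \<le> E / (2 * a) * sqrt (real T)"
    proof -
      \<comment> \<open>For \<open>s = 0\<close> this may add round 0, which the regret does not
        count; its expectation is non-negative.\<close>
      have "(\<Sum>t\<in>{1..<T}. expectation (r t)) \<le> (\<Sum>t\<in>{s..<T}. expectation (r t))"
        using s r_nonneg by (intro sum_mono2) auto
      also have "\<dots> = (\<Sum>j<n. expectation (r (s + j)))"
        using sum.atLeastLessThan_shift_0[of "\<lambda>t. expectation (r t)" s T]
        by (simp add: n_def atLeast0LessThan add.commute)
      also have "\<dots> \<le> E / (2 * \<alpha>)"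
      proof -
        have "0 \<le> e T" by (simp add: e_def)
        then have "(2 * \<alpha>) * (\<Sum>j<n. expectation (r (s + j))) \<le> E" using main by linarith
        then show ?thesis using \<alpha> by (simp add: pos_le_divide_eq mult.commute)
      qed
      also have "\<dots> = E / (2 * a) * sqrt (real T)" by (simp add: \<alpha>_def)
      finally show ?thesis .
    qed
    have Tin: "T \<in> {s..T}" using s T by simp
    \<comment> \<open>The \<epsilon>-subgradient inequality bounds \<open>r T\<close> by a quadratic
      in the distance, whose second moment \<open>e T\<close> is at most \<open>E\<close>. The
      resulting constant is multiplied by \<open>sqrt T\<close>, which is at least 1.\<close>
    have last: "expectation (r T) \<le> (q + B\<^sup>2 + (1 + L) * E) * sqrt (real T)"
    proof -
      have "r T \<omega> \<le> \<epsilon> + B\<^sup>2 + (1 + L) * (x T \<omega>)\<^sup>2" if \<omega>: "\<omega> \<in> space M" for \<omega>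
      proof -
        have "r T \<omega> \<le> \<epsilon> + (B + L * x T \<omega>) * x T \<omega>"
          using r_le[OF Tin \<omega>] g_growth[OF Tin \<omega> in_S[OF Tin \<omega>]] by (simp add: x_def)
        moreover have "B * x T \<omega> \<le> B\<^sup>2 + (x T \<omega>)\<^sup>2"
          using zero_le_power2[of "B - x T \<omega>"] zero_le_power2[of "B"] zero_le_power2[of "x T \<omega>"]
            by (simp only: power2_diff)
        ultimately show ?thesis by (simp add: power2_eq_square algebra_simps)
      qed
      then have "expectation (r T) \<le> expectation (\<lambda>\<omega>. \<epsilon> + B\<^sup>2 + (1 + L) * (x T \<omega>)\<^sup>2)"
        using r_integrable[OF Tin] x2_integrable[OF Tin] by (intro integral_mono) auto
      also have "\<dots> = \<epsilon> + B\<^sup>2 + (1 + L) * e T"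
        using x2_integrable[OF Tin] by (simp add: e_def prob_space)
      also have "\<dots> \<le> q + B\<^sup>2 + (1 + L) * E"
      proof -
        have "0 \<le> (2 * \<alpha>) * (\<Sum>j<n. expectation (r (s + j)))"
          using \<alpha> sn by (intro mult_nonneg_nonneg sum_nonneg r_nonneg) auto
        then have "(1 + L) * e T \<le> (1 + L) * E"
          using main L_nonneg by (intro mult_left_mono) auto
        moreover have "\<epsilon> \<le> q"
          using q sqrtT mult_left_mono[OF sqrtT(2) q] by (simp add: \<epsilon>_def pos_divide_le_eq)
        ultimately show ?thesis by simp
      qed
      also have "\<dots> \<le> (q + B\<^sup>2 + (1 + L) * E) * sqrt (real T)"
      proof -
        have "0 \<le> q + B\<^sup>2 + (1 + L) * E" using q L_nonneg E by simp
        then show ?thesis using mult_left_mono[OF sqrtT(2)] by fastforce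
      qed
      finally show ?thesis .
    qed
    have sub: "t \<in> {1..T} \<Longrightarrow> t \<in> {s..T}" for t using s by auto
    have regret_eq: "regret f c \<kappa> \<rho> \<Xi> T \<theta> \<gamma> \<xi> \<theta>s \<gamma>s \<omega> = (\<Sum>t=1..T. r t \<omega>)" if \<omega>: "\<omega> \<in> space M" for \<omega>
      unfolding regret_def
    proof (rule sum.cong[OF refl])
      fix t assume "t \<in> {1..T}"
      then have t: "t \<in> {s..T}" by (rule sub)
      show "real_of_ereal (dro_h f c \<kappa> \<rho> (\<theta> t \<omega>) (\<gamma> t \<omega>) (\<xi> t \<omega>) (worst_case f c \<kappa> \<rho> \<Xi> (\<theta> t \<omega>) (\<gamma> t \<omega>) (\<xi> t \<omega>)))
        - real_of_ereal (dro_h f c \<kappa> \<rho> \<theta>s \<gamma>s (\<xi> t \<omega>) (worst_case f c \<kappa> \<rho> \<Xi> \<theta>s \<gamma>s (\<xi> t \<omega>))) = r t \<omega>"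
        unfolding r_def
        using h_star_maximizer[OF in_dom(1,2,3)[OF t \<omega>]] h_star_maximizer[OF \<theta>s in_dom(3)[OF t \<omega>]]
        by metis
    qed
    have sum_int: "integrable M (\<lambda>\<omega>. \<Sum>t=1..T. r t \<omega>)"
      using r_integrable sub by (intro Bochner_Integration.integrable_sum) blast
    have regret_integral: "(\<integral>\<omega>. regret f c \<kappa> \<rho> \<Xi> T \<theta> \<gamma> \<xi> \<theta>s \<gamma>s \<omega> \<partial>M) = (\<Sum>t=1..T. expectation (r t))"
    proof -
      have "(\<integral>\<omega>. regret f c \<kappa> \<rho> \<Xi> T \<theta> \<gamma> \<xi> \<theta>s \<gamma>s \<omega> \<partial>M) = expectation (\<lambda>\<omega>. \<Sum>t=1..T. r t \<omega>)"
        by (rule Bochner_Integration.integral_cong) (simp_all add: regret_eq)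
      also have "\<dots> = (\<Sum>t=1..T. expectation (r t))"
        using r_integrable sub by (intro Bochner_Integration.integral_sum) blast
      finally show ?thesis .
    qed
    have "(\<Sum>t=1..T. expectation (r t)) = (\<Sum>t\<in>{1..<T}. expectation (r t)) + expectation (r T)"
      using T by (simp add: sum.last_plus add.commute)
    then have "(\<Sum>t=1..T. expectation (r t)) \<le> K * sqrt (real T)"
      using partial last by (simp add: K_def distrib_right)
    moreover have "0 \<le> (\<Sum>t=1..T. expectation (r t))"
      using r_nonneg sub by (intro sum_nonneg) blast
    moreover have "integrable M (regret f c \<kappa> \<rho> \<Xi> T \<theta> \<gamma> \<xi> \<theta>s \<gamma>s)"
      using sum_int regret_eq by (simp cong: Bochner_Integration.integrable_cong)
    ultimately show "integrable M (regret f c \<kappa> \<rho> \<Xi> T \<theta> \<gamma> \<xi> \<theta>s \<gamma>s) \<and>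
      0 \<le> (\<integral>\<omega>. regret f c \<kappa> \<rho> \<Xi> T \<theta> \<gamma> \<xi> \<theta>s \<gamma>s \<omega> \<partial>M) \<and>
      (\<integral>\<omega>. regret f c \<kappa> \<rho> \<Xi> T \<theta> \<gamma> \<xi> \<theta>s \<gamma>s \<omega> \<partial>M) \<le> K * sqrt (real T)"
      by (simp add: regret_integral)
  qed
qed

end

section \<open>The prescribed parameters and the rate of the regret\<close>

theorem corollary7:
  fixes f :: "real^'k \<Rightarrow> real^'p \<Rightarrow> 'z"
    and c :: "'z \<Rightarrow> real^'m \<Rightarrow> real"
    and \<kappa> :: ereal
    and \<Theta> :: "(real^'k) set"
    and \<Xi> :: "((real^'p) \<times> (real^'m)) set"
    and Q :: "((real^'p) \<times> (real^'m)) measure"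
    and \<theta>0 \<theta>s :: "real^'k"
    and \<rho> \<mu> \<Lambda> \<sigma>\<theta> \<sigma>\<gamma> L\<theta>\<theta> L\<theta>\<xi> L\<xi>\<theta> L\<xi>\<xi> L\<xi>\<gamma> \<gamma>0 \<gamma>s L :: real
  assumes L_def: "L = smoothness_const L\<theta>\<theta> L\<theta>\<xi> L\<xi>\<theta> L\<xi>\<gamma> \<mu>"
    and kappa: "0 < \<kappa>" and rho: "0 < \<rho>" and mu: "0 < \<mu>"
    and Q: "prob_space Q" "sets Q = sets borel" "AE \<xi> in Q. \<xi> \<in> \<Xi>"
    \<comment> \<open>well-posedness of \<open>h\<^sup>\<star>\<close>, \<open>H\<close> and their gradients\<close>
    and h_star_diff: "\<And>\<theta> \<gamma> \<xi>. \<theta> \<in> \<Theta> \<Longrightarrow> 0 < \<gamma> \<Longrightarrow> \<xi> \<in> \<Xi> \<Longrightarrow>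
          (\<lambda>w. dro_h_star f c \<kappa> \<rho> \<Xi> (fst w) (snd w) \<xi>) differentiable (at (\<theta>, \<gamma>))"
    and h_star_int: "\<And>\<theta> \<gamma>. \<theta> \<in> \<Theta> \<Longrightarrow> 0 < \<gamma> \<Longrightarrow> integrable Q (dro_h_star f c \<kappa> \<rho> \<Xi> \<theta> \<gamma>)"
    and H_diff: "\<And>\<theta> \<gamma>. \<theta> \<in> \<Theta> \<Longrightarrow> 0 < \<gamma> \<Longrightarrow>
          (\<lambda>w. dro_H f c \<kappa> \<rho> \<Xi> Q (fst w) (snd w)) differentiable (at (\<theta>, \<gamma>))"
    \<comment> \<open>the constants are Lipschitz constants, and the step size is well defined\<close>
    and nonneg: "0 \<le> L\<theta>\<theta>" "0 \<le> L\<theta>\<xi>" "0 \<le> L\<xi>\<theta>" "0 \<le> L\<xi>\<xi>" "0 \<le> L\<xi>\<gamma>"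
    and L_pos: "0 < L"
    and sigma_pos: "0 < \<sigma>\<theta>\<^sup>2 + \<sigma>\<gamma>\<^sup>2"
    and L\<xi>\<gamma>: "\<And>\<theta> \<gamma> \<gamma>' \<xi> \<xi>' g g'. \<theta> \<in> \<Theta> \<Longrightarrow> 0 < \<gamma> \<Longrightarrow> 0 < \<gamma>' \<Longrightarrow> \<xi> \<in> \<Xi> \<Longrightarrow> \<xi>' \<in> \<Xi> \<Longrightarrow>
          has_xi_gradient \<kappa> (dro_h f c \<kappa> \<rho> \<theta> \<gamma> \<xi>) \<xi>' g \<Longrightarrow>
          has_xi_gradient \<kappa> (dro_h f c \<kappa> \<rho> \<theta> \<gamma>' \<xi>) \<xi>' g' \<Longrightarrow>
          xi_dual_norm \<kappa> (g - g') \<le> ereal (L\<xi>\<gamma> * \<bar>\<gamma> - \<gamma>'\<bar>)"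
    and A1: "compact \<Xi>"
    and A2: "lipschitz_smooth_loss \<kappa> \<Theta> \<Xi> (policy_loss f c) L\<theta>\<theta> L\<theta>\<xi> L\<xi>\<theta> L\<xi>\<xi>"
    and A3: "\<And>\<theta> \<gamma> \<xi>. \<theta> \<in> \<Theta> \<Longrightarrow> 0 < \<gamma> \<Longrightarrow> \<xi> \<in> \<Xi> \<Longrightarrow>
          strongly_concave_on \<kappa> \<mu> \<Xi> (dro_h f c \<kappa> \<rho> \<theta> \<gamma> \<xi>)"
    and A4_theta: "\<And>\<theta> \<gamma>. \<theta> \<in> \<Theta> \<Longrightarrow> 0 < \<gamma> \<Longrightarrow>
          (\<integral>\<^sup>+\<xi>. ennreal ((norm (grad (\<lambda>\<eta>. dro_H f c \<kappa> \<rho> \<Xi> Q \<eta> \<gamma>) \<theta>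
                              - grad (\<lambda>\<eta>. dro_h_star f c \<kappa> \<rho> \<Xi> \<eta> \<gamma> \<xi>) \<theta>))\<^sup>2) \<partial>Q)
            \<le> ennreal (\<sigma>\<theta>\<^sup>2)"
    and A4_gamma: "\<And>\<theta> \<gamma>. \<theta> \<in> \<Theta> \<Longrightarrow> 0 < \<gamma> \<Longrightarrow>
          (\<integral>\<^sup>+\<xi>. ennreal ((norm (grad (\<lambda>\<eta>. dro_H f c \<kappa> \<rho> \<Xi> Q \<theta> \<eta>) \<gamma>
                              - grad (\<lambda>\<eta>. dro_h_star f c \<kappa> \<rho> \<Xi> \<theta> \<eta> \<xi>) \<gamma>))\<^sup>2) \<partial>Q)
            \<le> ennreal (\<sigma>\<gamma>\<^sup>2)"
    and init: "\<theta>0 \<in> \<Theta>" "0 < \<gamma>0"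
    and A4_gap: "0 < \<Lambda>"
          "dro_H f c \<kappa> \<rho> \<Xi> Q \<theta>0 \<gamma>0
             - (INF w\<in>\<Theta> \<times> {0<..}. dro_H f c \<kappa> \<rho> \<Xi> Q (fst w) (snd w)) \<le> \<Lambda>"
    and minimizer: "\<theta>s \<in> \<Theta>" "0 < \<gamma>s"
          "\<And>\<theta> \<gamma>. \<theta> \<in> \<Theta> \<Longrightarrow> 0 < \<gamma> \<Longrightarrow> dro_H f c \<kappa> \<rho> \<Xi> Q \<theta>s \<gamma>s \<le> dro_H f c \<kappa> \<rho> \<Xi> Q \<theta> \<gamma>"
    and convex_theta: "\<And>\<gamma> \<xi> \<xi>'. 0 < \<gamma> \<Longrightarrow> \<xi> \<in> \<Xi> \<Longrightarrow> \<xi>' \<in> \<Xi> \<Longrightarrow>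
          transport_cost \<kappa> \<xi>' \<xi> < \<infinity> \<Longrightarrow>
          convex_on \<Theta> (\<lambda>\<theta>. real_of_ereal (dro_h f c \<kappa> \<rho> \<theta> \<gamma> \<xi> \<xi>'))"
  shows
    \<comment> \<open>\<open>s\<close> is the index carried by the initial weights\<close>
    "(\<exists>K. \<forall>T\<ge>1. \<forall>s\<le>1. \<forall>(M :: 'w measure) \<theta> \<gamma> \<xi> \<zeta>.
        online_da_sgd_run f c \<kappa> \<rho> \<Theta> \<Xi> Q
          (step_size \<Lambda> L \<sigma>\<theta> \<sigma>\<gamma> T) (step_size \<Lambda> L \<sigma>\<theta> \<sigma>\<gamma> T) (inner_tolerance \<mu> L\<theta>\<xi> T)
          \<theta>0 \<gamma>0 s T M \<theta> \<gamma> \<xi> \<zeta> \<longrightarrow>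
        integrable M (regret f c \<kappa> \<rho> \<Xi> T \<theta> \<gamma> \<xi> \<theta>s \<gamma>s) \<and>
        (\<integral>\<omega>. regret f c \<kappa> \<rho> \<Xi> T \<theta> \<gamma> \<xi> \<theta>s \<gamma>s \<omega> \<partial>M) \<le> K * sqrt (real T) \<and>
        \<bar>(\<integral>\<omega>. regret f c \<kappa> \<rho> \<Xi> T \<theta> \<gamma> \<xi> \<theta>s \<gamma>s \<omega> \<partial>M) / real T\<bar> \<le> K / sqrt (real T)) \<and>
     (\<forall>\<delta>>0. \<exists>T0\<ge>1. \<forall>T\<ge>T0. \<forall>s\<le>1. \<forall>(M :: 'w measure) \<theta> \<gamma> \<xi> \<zeta>.
        online_da_sgd_run f c \<kappa> \<rho> \<Theta> \<Xi> Q
          (step_size \<Lambda> L \<sigma>\<theta> \<sigma>\<gamma> T) (step_size \<Lambda> L \<sigma>\<theta> \<sigma>\<gamma> T) (inner_tolerance \<mu> L\<theta>\<xi> T)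
          \<theta>0 \<gamma>0 s T M \<theta> \<gamma> \<xi> \<zeta> \<longrightarrow>
        (\<integral>\<omega>. regret f c \<kappa> \<rho> \<Xi> T \<theta> \<gamma> \<xi> \<theta>s \<gamma>s \<omega> \<partial>M) \<le> \<delta> * real T)"
proof -
  interpret convex_dro f c \<kappa> \<rho> L\<theta>\<theta> \<Theta> \<Xi>
  proof
    fix \<theta> assume \<theta>: "\<theta> \<in> \<Theta>"
    have "policy_loss f c \<theta> differentiable (at \<xi>)" if "\<xi> \<in> \<Xi>" for \<xi>
      using A2 \<theta> that unfolding lipschitz_smooth_loss_def by blast
    then show "continuous_on \<Xi> (policy_loss f c \<theta>)"
      by (intro continuous_at_imp_continuous_on ballI differentiable_imp_continuous_within)
  next
    fix \<xi> assume \<xi>: "\<xi> \<in> \<Xi>"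
    have cost: "transport_cost \<kappa> \<xi> \<xi> = 0"
      by (simp add: transport_cost_def xi_norm_def zero_ereal_def[symmetric])
    \<comment> \<open>Leaving \<xi> in place costs nothing, so at \<gamma> = 1 the function h is the
      loss plus a constant and hands its convexity over to the loss.\<close>
    have h: "real_of_ereal (dro_h f c \<kappa> \<rho> \<theta> 1 \<xi> \<xi>) = policy_loss f c \<theta> \<xi> + \<rho>" for \<theta>
      by (simp add: dro_h_def cost)
    have "convex_on \<Theta> (\<lambda>\<theta>. policy_loss f c \<theta> \<xi> + \<rho>)"
      using convex_theta[of 1 \<xi> \<xi>] \<xi> cost by (simp add: h)
    then show "convex_on \<Theta> (\<lambda>\<theta>. policy_loss f c \<theta> \<xi>)"
      using convex_on_add[of \<Theta> "\<lambda>\<theta>. policy_loss f c \<theta> \<xi> + \<rho>" "\<lambda>_. - \<rho>"]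
      by (simp add: convex_on_const convex_on_imp_convex)
  qed (use A2 kappa rho nonneg A1 in \<open>auto simp: lipschitz_smooth_loss_def\<close>)
  \<comment> \<open>\<open>a\<close> and \<open>q\<close> are the factors of the step size and the
    tolerance that do not depend on \<open>T\<close>.\<close>
  define a where "a = sqrt (\<Lambda> / (L * (\<sigma>\<theta>\<^sup>2 + \<sigma>\<gamma>\<^sup>2)))"
  define q where "q = \<mu> / (L\<theta>\<xi>\<^sup>2 + 1)"
  have a: "0 < a" using A4_gap(1) L_pos sigma_pos by (simp add: a_def)
  have q: "0 \<le> q" using mu by (simp add: q_def add_nonneg_pos)
  have step: "step_size \<Lambda> L \<sigma>\<theta> \<sigma>\<gamma> T = a / sqrt (real T)" for T
    by (simp add: step_size_def a_def real_sqrt_divide real_sqrt_mult)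
  have tol: "inner_tolerance \<mu> L\<theta>\<xi> T = q / sqrt (real T)" for T
    by (simp add: inner_tolerance_def q_def)
  have "continuous_on (\<Theta> \<times> {0<..}) (\<lambda>w. h_star (fst w) (snd w) \<xi>)" if "\<xi> \<in> \<Xi>" for \<xi>
    by (intro continuous_at_imp_continuous_on ballI differentiable_imp_continuous_within)
      (use h_star_diff[OF _ _ that] in auto)
  from online_regret_bound[OF Q(2) this h_star_int minimizer a q]
  obtain K where K: "\<forall>T\<ge>1. \<forall>s\<le>1. \<forall>(M :: 'w measure) \<theta> \<gamma> \<xi> \<zeta>.
      online_da_sgd_run f c \<kappa> \<rho> \<Theta> \<Xi> Q (a / sqrt (real T)) (a / sqrt (real T)) (q / sqrt (real T))
        \<theta>0 \<gamma>0 s T M \<theta> \<gamma> \<xi> \<zeta> \<longrightarrow>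
      integrable M (regret f c \<kappa> \<rho> \<Xi> T \<theta> \<gamma> \<xi> \<theta>s \<gamma>s) \<and>
      0 \<le> (\<integral>\<omega>. regret f c \<kappa> \<rho> \<Xi> T \<theta> \<gamma> \<xi> \<theta>s \<gamma>s \<omega> \<partial>M) \<and>
      (\<integral>\<omega>. regret f c \<kappa> \<rho> \<Xi> T \<theta> \<gamma> \<xi> \<theta>s \<gamma>s \<omega> \<partial>M) \<le> K * sqrt (real T)" ..
  show ?thesis
    unfolding step tol
  proof (intro conjI exI[of _ K] allI impI)
    fix T s :: nat and M :: "'w measure" and \<theta> \<gamma> \<xi> \<zeta>
    assume T: "1 \<le> T" and s: "s \<le> 1"
      and run: "online_da_sgd_run f c \<kappa> \<rho> \<Theta> \<Xi> Q (a / sqrt (real T)) (a / sqrt (real T))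
        (q / sqrt (real T)) \<theta>0 \<gamma>0 s T M \<theta> \<gamma> \<xi> \<zeta>"
    let ?R = "\<integral>\<omega>. regret f c \<kappa> \<rho> \<Xi> T \<theta> \<gamma> \<xi> \<theta>s \<gamma>s \<omega> \<partial>M"
    show "integrable M (regret f c \<kappa> \<rho> \<Xi> T \<theta> \<gamma> \<xi> \<theta>s \<gamma>s)" "?R \<le> K * sqrt (real T)"
      using K[rule_format, OF T s run] by auto
    have "?R / real T \<le> K * sqrt (real T) / real T"
      using K[rule_format, OF T s run] by (intro divide_right_mono) auto
    also have "\<dots> = K / sqrt (real T)"
      using T by (simp add: field_simps)
    \<comment> \<open>The expected regret is non-negative, so the upper bound also bounds the
      absolute value.\<close>
    finally show "\<bar>?R / real T\<bar> \<le> K / sqrt (real T)"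
      using K[rule_format, OF T s run] by simp
  next
    fix \<delta> :: real assume \<delta>: "0 < \<delta>"
    \<comment> \<open>From this threshold on, \<open>K\<close> is at most
      \<open>\<delta> * sqrt T\<close>, which absorbs the constant into the slope \<delta>.\<close>
    obtain T0 :: nat where T0: "(K / \<delta>)\<^sup>2 \<le> real T0" using real_arch_simple by blast
    show "\<exists>T0\<ge>1. \<forall>T\<ge>T0. \<forall>s\<le>1. \<forall>(M :: 'w measure) \<theta> \<gamma> \<xi> \<zeta>.
      online_da_sgd_run f c \<kappa> \<rho> \<Theta> \<Xi> Q (a / sqrt (real T)) (a / sqrt (real T)) (q / sqrt (real T))
        \<theta>0 \<gamma>0 s T M \<theta> \<gamma> \<xi> \<zeta> \<longrightarrow>
      (\<integral>\<omega>. regret f c \<kappa> \<rho> \<Xi> T \<theta> \<gamma> \<xi> \<theta>s \<gamma>s \<omega> \<partial>M) \<le> \<delta> * real T"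
    proof (intro exI[of _ "max 1 T0"] conjI allI impI)
      fix T s :: nat and M :: "'w measure" and \<theta> \<gamma> \<xi> \<zeta>
      assume T: "max 1 T0 \<le> T" and s: "s \<le> 1"
        and run: "online_da_sgd_run f c \<kappa> \<rho> \<Theta> \<Xi> Q (a / sqrt (real T)) (a / sqrt (real T))
          (q / sqrt (real T)) \<theta>0 \<gamma>0 s T M \<theta> \<gamma> \<xi> \<zeta>"
      have "K / \<delta> \<le> sqrt (real T)"
        using T T0 by (intro real_le_rsqrt) auto
      then have "K \<le> \<delta> * sqrt (real T)" using \<delta> by (simp add: pos_divide_le_eq mult.commute)
      then have "K * sqrt (real T) \<le> \<delta> * sqrt (real T) * sqrt (real T)"
        by (intro mult_right_mono) auto
      also have "\<dots> = \<delta> * real T" by (simp add: mult.assoc)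
      finally show "(\<integral>\<omega>. regret f c \<kappa> \<rho> \<Xi> T \<theta> \<gamma> \<xi> \<theta>s \<gamma>s \<omega> \<partial>M) \<le> \<delta> * real T"
        using K[rule_format, OF _ s run] T by simp
    qed simp
  qed
qed

end
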